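(* Let $X$ and $Y$ be real Banach spaces with preduals $X_*$ and $Y_*$, where $X_*$ is separable or reflexive. Let $K\colon X\to Y$ be a bounded dilinear mapping, $R\colon X\to\overline{\mathbb R}$ a non-negative, proper, diconvex functional, $g^\delta\in Y$, $p\ge1$, $\alpha>0$, and put $$J_\alpha(u):=\|K(u)-g^\delta\|^p+\alpha R(u)\qquad(u\in X).$$ Assume that (i) $J_\alpha(u)\to+\infty$ whenever $\|u\|\to+\infty$; (ii) $R$ is sequentially weakly$*$ lower semi-continuous; (iii) $K$ is sequentially weakly$*$ continuous. Let $(g_n)_{n\in\mathbb N}$ be a sequence in $Y$ converging to $g^\delta$, and let $(u_n)_{n\in\mathbb N}$ be a sequence of minimizers of the Tikhonov functional with $g_n$ in place of $g^\delta$, i.e. $u_n$ minimizes $u\mapsto\|K(u)-g_n\|^p+\alpha R(u)$ over $X$. Then: (a) $(u_n)_{n\in\mathbb N}$ contains a subsequence that converges weakly$*$ to a minimizer $u_\alpha^\delta$ of $J_\alpha$. (b) If the minimizer of $J_\alpha$ is unique, then the complete sequence $(u_n)_{n\in\mathbb N}$ converges weakly$*$. (c) If the functional $R$ possesses the H-property on $X$, then the sequence $(u_n)_{n\in\mathbb N}$ converges in norm topology.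
   Context: $\overline{\mathbb R}=\mathbb R\cup\{\pm\infty\}$; a functional is proper if it is never $-\infty$ and not identically $+\infty$. For a real Banach space $X$, $X\otimes_\pi X$ is the (completed) projective tensor product and $X\otimes_{\pi,\mathrm{sym}}X$ is its closed subspace spanned by the tensors $u\otimes u$, $u\in X$. A mapping $K\colon X\to Y$ is dilinear if there is a linear $\breve K\colon X\times(X\otimes_{\pi,\mathrm{sym}}X)\to Y$ with $K(u)=\breve K(u,u\otimes u)$ for all $u\in X$; it is bounded if $\breve K$ is bounded. A mapping $F\colon X\to\overline{\mathbb R}$ is diconvex if there is a proper, convex $\breve F\colon X\times(X\otimes_{\pi,\mathrm{sym}}X)\to\overline{\mathbb R}$ with $F(u)=\breve F(u,u\otimes u)$ for all $u\in X$. Weak$*$ topologies on $X$ and $Y$ are those induced by the preduals $X_*$ and $Y_*$. A functional $R\colon X\to\overline{\mathbb R}$ has the H-property on $X$ if any weakly$*$ convergent sequence $(u_n)$ in $X$ with limit $u$ and with $R(u_n)\to R(u)$ converges to $u$ strongly (in norm).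
   Formalization: Part (c) fails literally (K(u)=R(u)=u² on ℝ, p=2, α=1, g_n=1, u_n=(−1)ⁿ/√2); here the H-property gives norm convergence of each subsequence converging weakly* to a minimizer, and of the complete sequence if the minimizer is unique. *)

theory Defs
  imports "HOL-Analysis.Analysis"
begin

section \<open>The algebraic tensor product\<close>

text \<open>A list of pairs stands for the formal sum of the elementary tensors of its entries; formal
  sums are identified if all (not only the bounded) real bilinear forms agree on them.\<close>

definition bform_sum :: "('a \<Rightarrow> 'b \<Rightarrow> real) \<Rightarrow> ('a \<times> 'b) list \<Rightarrow> real" where
  "bform_sum B xs = (\<Sum>(x, y)\<leftarrow>xs. B x y)"

lemma bform_sum_simps [simp]:
  "bform_sum B [] = 0"
  "bform_sum B ((x, y) # xs) = B x y + bform_sum B xs"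
  "bform_sum B (xs @ ys) = bform_sum B xs + bform_sum B ys"
  by (simp_all add: bform_sum_def)

lemma bform_sum_scale:
  assumes "bilinear B"
  shows "bform_sum B (map (\<lambda>(x, y). (r *\<^sub>R x, y)) xs) = r * bform_sum B xs"
  by (induction xs) (auto simp: bilinear_lmul[OF assms] distrib_left)

quotient_type (overloaded) ('a, 'b) tensor =
  "('a::real_vector \<times> 'b::real_vector) list" /
  "\<lambda>xs ys. \<forall>B. bilinear B \<longrightarrow> bform_sum B xs = bform_sum B ys"
  by (intro equivpI reflpI sympI transpI) auto

instantiation tensor :: (real_vector, real_vector) real_vector
begin

lift_definition zero_tensor :: "('a, 'b) tensor" is "[]" .

lift_definition plus_tensor :: "('a, 'b) tensor \<Rightarrow> ('a, 'b) tensor \<Rightarrow> ('a, 'b) tensor"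
  is "(@)" by auto

lift_definition scaleR_tensor :: "real \<Rightarrow> ('a, 'b) tensor \<Rightarrow> ('a, 'b) tensor"
  is "\<lambda>r. map (\<lambda>(x, y). (r *\<^sub>R x, y))" by (simp add: bform_sum_scale)

definition uminus_tensor :: "('a, 'b) tensor \<Rightarrow> ('a, 'b) tensor" where
  "uminus_tensor t = (-1) *\<^sub>R t"

definition minus_tensor :: "('a, 'b) tensor \<Rightarrow> ('a, 'b) tensor \<Rightarrow> ('a, 'b) tensor" where
  "minus_tensor s t = s + (-1) *\<^sub>R t"

instance
proof
  fix s t u :: "('a, 'b) tensor" and q r :: real
  show "s + t + u = s + (t + u)" by transfer auto
  show "s + t = t + s" by transfer auto
  show "0 + t = t" by transfer auto
  show "- t + t = 0" unfolding uminus_tensor_def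
    by transfer (intro allI impI, simp only: bform_sum_simps bform_sum_scale)
  show "s - t = s + - t" by (simp add: uminus_tensor_def minus_tensor_def)
  show "r *\<^sub>R (s + t) = r *\<^sub>R s + r *\<^sub>R t"
    by transfer auto
  show "(q + r) *\<^sub>R t = q *\<^sub>R t + r *\<^sub>R t"
    by transfer (simp add: bform_sum_scale distrib_right)
  show "q *\<^sub>R r *\<^sub>R t = (q * r) *\<^sub>R t"
    by transfer (simp add: bform_sum_scale del: map_map)
  show "1 *\<^sub>R t = t"
    by transfer (simp add: bform_sum_scale)
qed

end

section \<open>The projective norm\<close>

definition tensor_cost :: "('a::real_normed_vector \<times> 'b::real_normed_vector) list \<Rightarrow> real" where
  "tensor_cost xs = (\<Sum>(x, y)\<leftarrow>xs. norm x * norm y)"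

definition proj_norm :: "('a::real_normed_vector, 'b::real_normed_vector) tensor \<Rightarrow> real" where
  "proj_norm t = Inf {tensor_cost xs | xs. abs_tensor xs = t}"

lemma tensor_cost_simps [simp]:
  "tensor_cost [] = 0"
  "tensor_cost ((x, y) # xs) = norm x * norm y + tensor_cost xs"
  "tensor_cost (xs @ ys) = tensor_cost xs + tensor_cost ys"
  by (simp_all add: tensor_cost_def)

lemma tensor_cost_nonneg: "0 \<le> tensor_cost xs"
  by (induction xs) auto

lemma tensor_cost_scale:
  "tensor_cost (map (\<lambda>(x, y). (r *\<^sub>R x, y)) xs) = \<bar>r\<bar> * tensor_cost xs"
  by (induction xs) (auto simp: algebra_simps)

lemma abs_tensor_surj: "\<exists>xs. abs_tensor xs = t"
  by (induction t rule: tensor.abs_induct) blast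

lemma proj_norm_le: "abs_tensor xs = t \<Longrightarrow> proj_norm t \<le> tensor_cost xs"
  unfolding proj_norm_def
  by (rule cInf_lower) (auto intro!: bdd_belowI[of _ 0] tensor_cost_nonneg)

lemma proj_norm_greatest:
  "(\<And>xs. abs_tensor xs = t \<Longrightarrow> c \<le> tensor_cost xs) \<Longrightarrow> c \<le> proj_norm t"
  unfolding proj_norm_def using abs_tensor_surj[of t] by (intro cInf_greatest) auto

lemma proj_norm_nonneg: "0 \<le> proj_norm t"
  by (rule proj_norm_greatest) (rule tensor_cost_nonneg)

lemma proj_norm_zero [simp]:
  "proj_norm (0 :: ('a::real_normed_vector, 'b::real_normed_vector) tensor) = 0"
proof (rule antisym)
  show "proj_norm (0 :: ('a, 'b) tensor) \<le> 0"
    using proj_norm_le[of "[]" 0] by (simp add: zero_tensor_def)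
qed (rule proj_norm_nonneg)

lemma proj_norm_triangle: "proj_norm (s + t) \<le> proj_norm s + proj_norm t"
proof -
  have *: "proj_norm (s + t) \<le> tensor_cost xs + tensor_cost ys"
    if "abs_tensor xs = s" "abs_tensor ys = t" for xs ys
    using proj_norm_le[of "xs @ ys" "s + t"] that by (auto simp: plus_tensor.abs_eq)
  have **: "proj_norm (s + t) - tensor_cost ys \<le> proj_norm s" if "abs_tensor ys = t" for ys
    by (rule proj_norm_greatest) (use *[OF _ that] in \<open>simp add: diff_le_eq\<close>)
  have "proj_norm (s + t) - proj_norm s \<le> proj_norm t"
  proof (rule proj_norm_greatest)
    fix ys assume "abs_tensor ys = t"
    from **[OF this] show "proj_norm (s + t) - proj_norm s \<le> tensor_cost ys" by simp
  qed
  then show ?thesis by simp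
qed

lemma proj_norm_scaleR: "proj_norm (r *\<^sub>R t) = \<bar>r\<bar> * proj_norm t"
proof -
  have le: "proj_norm (r *\<^sub>R t) \<le> \<bar>r\<bar> * proj_norm t" if "r \<noteq> 0"
    for r and t :: "('a, 'b) tensor"
  proof -
    have "proj_norm (r *\<^sub>R t) / \<bar>r\<bar> \<le> proj_norm t"
    proof (rule proj_norm_greatest)
      fix xs assume "abs_tensor xs = t"
      then have "proj_norm (r *\<^sub>R t) \<le> \<bar>r\<bar> * tensor_cost xs"
        using proj_norm_le[of "map (\<lambda>(x, y). (r *\<^sub>R x, y)) xs" "r *\<^sub>R t"]
        by (auto simp: scaleR_tensor.abs_eq tensor_cost_scale)
      then show "proj_norm (r *\<^sub>R t) / \<bar>r\<bar> \<le> tensor_cost xs"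
        using that by (simp add: field_simps)
    qed
    then show ?thesis using that by (simp add: field_simps)
  qed
  show ?thesis
  proof (cases "r = 0")
    case False
    have "proj_norm (inverse r *\<^sub>R (r *\<^sub>R t)) \<le> \<bar>inverse r\<bar> * proj_norm (r *\<^sub>R t)"
      using False by (intro le) auto
    then have "\<bar>r\<bar> * proj_norm t \<le> proj_norm (r *\<^sub>R t)"
      using False by (simp add: field_simps)
    with le[OF False] show ?thesis by (metis antisym)
  qed simp
qed

lemma proj_norm_minus_commute: "proj_norm (s - t) = proj_norm (t - s)"
  using proj_norm_scaleR[of "-1" "s - t"] by simp

lemma proj_norm_diff_triangle: "proj_norm (s - u) \<le> proj_norm (s - t) + proj_norm (t - u)"
  using proj_norm_triangle[of "s - t" "t - u"] by simp

lemma proj_norm_abs_diff: "\<bar>proj_norm s - proj_norm t\<bar> \<le> proj_norm (s - t)"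
  using proj_norm_triangle[of "s - t" t] proj_norm_triangle[of "t - s" s]
  by (simp add: proj_norm_minus_commute[of t s] abs_if)

section \<open>The completed projective tensor product\<close>

text \<open>Cauchy sequences of algebraic tensors modulo null sequences.\<close>

definition proj_Cauchy :: "(nat \<Rightarrow> ('a::real_normed_vector, 'b::real_normed_vector) tensor) \<Rightarrow> bool" where
  "proj_Cauchy s \<longleftrightarrow> (\<forall>e>0. \<exists>N. \<forall>m\<ge>N. \<forall>n\<ge>N. proj_norm (s m - s n) < e)"

lemma proj_null_add:
  assumes "(\<lambda>n. proj_norm (s n)) \<longlonglongrightarrow> 0" "(\<lambda>n. proj_norm (t n)) \<longlonglongrightarrow> 0"
  shows "(\<lambda>n. proj_norm (s n + t n)) \<longlonglongrightarrow> 0"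
  by (rule real_tendsto_sandwich[OF _ _ tendsto_const tendsto_add_zero[OF assms]])
     (auto simp: proj_norm_nonneg proj_norm_triangle)

lemma proj_Cauchy_const [simp]: "proj_Cauchy (\<lambda>_. t)"
  by (simp add: proj_Cauchy_def)

lemma proj_Cauchy_add:
  assumes "proj_Cauchy s" "proj_Cauchy t"
  shows "proj_Cauchy (\<lambda>n. s n + t n)"
  unfolding proj_Cauchy_def
proof (intro allI impI)
  fix e :: real assume "e > 0"
  then have "e / 2 > 0" by simp
  with assms obtain M N where
    M: "\<And>m n. m \<ge> M \<Longrightarrow> n \<ge> M \<Longrightarrow> proj_norm (s m - s n) < e / 2" and
    N: "\<And>m n. m \<ge> N \<Longrightarrow> n \<ge> N \<Longrightarrow> proj_norm (t m - t n) < e / 2"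
    unfolding proj_Cauchy_def by metis
  have "proj_norm (s m + t m - (s n + t n)) < e" if "m \<ge> max M N" "n \<ge> max M N" for m n
    using proj_norm_triangle[of "s m - s n" "t m - t n"] M[of m n] N[of m n] that
    by (simp add: algebra_simps)
  then show "\<exists>N. \<forall>m\<ge>N. \<forall>n\<ge>N. proj_norm (s m + t m - (s n + t n)) < e" by blast
qed

lemma proj_Cauchy_scaleR:
  assumes "proj_Cauchy s"
  shows "proj_Cauchy (\<lambda>n. r *\<^sub>R s n)"
  unfolding proj_Cauchy_def
proof (intro allI impI)
  fix e :: real assume "e > 0"
  then have "e / (\<bar>r\<bar> + 1) > 0" by simp
  with assms obtain N where
    N: "\<And>m n. m \<ge> N \<Longrightarrow> n \<ge> N \<Longrightarrow> proj_norm (s m - s n) < e / (\<bar>r\<bar> + 1)"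
    unfolding proj_Cauchy_def by metis
  have "proj_norm (r *\<^sub>R s m - r *\<^sub>R s n) < e" if "m \<ge> N" "n \<ge> N" for m n
  proof -
    have "proj_norm (r *\<^sub>R s m - r *\<^sub>R s n) = \<bar>r\<bar> * proj_norm (s m - s n)"
      by (metis proj_norm_scaleR scaleR_diff_right)
    also have "\<dots> \<le> (\<bar>r\<bar> + 1) * proj_norm (s m - s n)"
      by (simp add: distrib_right proj_norm_nonneg)
    also have "\<dots> < e" using N[OF that] by (simp add: field_simps)
    finally show ?thesis .
  qed
  then show "\<exists>N. \<forall>m\<ge>N. \<forall>n\<ge>N. proj_norm (r *\<^sub>R s m - r *\<^sub>R s n) < e" by blast
qed

lemma proj_Cauchy_norm_convergent:
  assumes "proj_Cauchy s"
  shows "convergent (\<lambda>n. proj_norm (s n))"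
proof -
  have "Cauchy (\<lambda>n. proj_norm (s n))"
    unfolding Cauchy_def dist_real_def
    using assms proj_norm_abs_diff unfolding proj_Cauchy_def by (meson le_less_trans)
  then show ?thesis by (simp add: Cauchy_convergent_iff)
qed

quotient_type (overloaded) ('a, 'b) proj_tensor =
  "nat \<Rightarrow> ('a::real_normed_vector, 'b::real_normed_vector) tensor" /
  partial: "\<lambda>s t. proj_Cauchy s \<and> proj_Cauchy t \<and> (\<lambda>n. proj_norm (s n - t n)) \<longlonglongrightarrow> 0"
proof (intro part_equivpI sympI transpI)
  show "\<exists>s. proj_Cauchy s \<and> proj_Cauchy s \<and> (\<lambda>n. proj_norm (s n - s n)) \<longlonglongrightarrow> 0"
    by (rule exI[of _ "\<lambda>_. 0"]) simp
next
  fix s t :: "nat \<Rightarrow> ('a, 'b) tensor"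
  assume "proj_Cauchy s \<and> proj_Cauchy t \<and> (\<lambda>n. proj_norm (s n - t n)) \<longlonglongrightarrow> 0"
  then show "proj_Cauchy t \<and> proj_Cauchy s \<and> (\<lambda>n. proj_norm (t n - s n)) \<longlonglongrightarrow> 0"
    by (simp add: proj_norm_minus_commute)
next
  fix s t u :: "nat \<Rightarrow> ('a, 'b) tensor"
  assume "proj_Cauchy s \<and> proj_Cauchy t \<and> (\<lambda>n. proj_norm (s n - t n)) \<longlonglongrightarrow> 0"
    "proj_Cauchy t \<and> proj_Cauchy u \<and> (\<lambda>n. proj_norm (t n - u n)) \<longlonglongrightarrow> 0"
  then show "proj_Cauchy s \<and> proj_Cauchy u \<and> (\<lambda>n. proj_norm (s n - u n)) \<longlonglongrightarrow> 0"
    using proj_null_add[of "\<lambda>n. s n - t n" "\<lambda>n. t n - u n"] by simp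
qed

instantiation proj_tensor :: (real_normed_vector, real_normed_vector) real_normed_vector
begin

lift_definition zero_proj_tensor :: "('a, 'b) proj_tensor" is "\<lambda>_. 0" by simp

lift_definition plus_proj_tensor ::
  "('a, 'b) proj_tensor \<Rightarrow> ('a, 'b) proj_tensor \<Rightarrow> ('a, 'b) proj_tensor"
  is "\<lambda>s t n. s n + t n"
  using proj_null_add by (force simp: proj_Cauchy_add add_diff_add)

lift_definition scaleR_proj_tensor :: "real \<Rightarrow> ('a, 'b) proj_tensor \<Rightarrow> ('a, 'b) proj_tensor"
  is "\<lambda>r s n. r *\<^sub>R s n"
  by (auto simp: proj_Cauchy_scaleR proj_norm_scaleR tendsto_mult_right_zero
      simp flip: scaleR_diff_right)

lift_definition norm_proj_tensor :: "('a, 'b) proj_tensor \<Rightarrow> real"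
  is "\<lambda>s. lim (\<lambda>n. proj_norm (s n))"
proof (elim conjE)
  fix s t :: "nat \<Rightarrow> ('a, 'b) tensor"
  assume *: "proj_Cauchy s" "proj_Cauchy t" "(\<lambda>n. proj_norm (s n - t n)) \<longlonglongrightarrow> 0"
  have "(\<lambda>n. proj_norm (s n) - proj_norm (t n)) \<longlonglongrightarrow> 0"
    by (rule Lim_null_comparison[OF _ *(3)]) (simp add: proj_norm_abs_diff)
  moreover have "(\<lambda>n. proj_norm (t n)) \<longlonglongrightarrow> lim (\<lambda>n. proj_norm (t n))"
    using proj_Cauchy_norm_convergent[OF *(2)] by (simp add: convergent_LIMSEQ_iff)
  ultimately have "(\<lambda>n. proj_norm (s n)) \<longlonglongrightarrow> lim (\<lambda>n. proj_norm (t n))"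
    using tendsto_add by fastforce
  then show "lim (\<lambda>n. proj_norm (s n)) = lim (\<lambda>n. proj_norm (t n))" by (rule limI)
qed

definition uminus_proj_tensor :: "('a, 'b) proj_tensor \<Rightarrow> ('a, 'b) proj_tensor" where
  "uminus_proj_tensor t = (-1) *\<^sub>R t"

definition minus_proj_tensor ::
  "('a, 'b) proj_tensor \<Rightarrow> ('a, 'b) proj_tensor \<Rightarrow> ('a, 'b) proj_tensor" where
  "minus_proj_tensor s t = s + (-1) *\<^sub>R t"

definition dist_proj_tensor :: "('a, 'b) proj_tensor \<Rightarrow> ('a, 'b) proj_tensor \<Rightarrow> real" where
  "dist_proj_tensor s t = norm (s - t)"

definition sgn_proj_tensor :: "('a, 'b) proj_tensor \<Rightarrow> ('a, 'b) proj_tensor" where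
  "sgn_proj_tensor t = inverse (norm t) *\<^sub>R t"

definition uniformity_proj_tensor ::
  "(('a, 'b) proj_tensor \<times> ('a, 'b) proj_tensor) filter" where
  "uniformity_proj_tensor = (INF e\<in>{0 <..}. principal {(x, y). dist x y < e})"

definition open_proj_tensor :: "('a, 'b) proj_tensor set \<Rightarrow> bool" where
  "open_proj_tensor S \<longleftrightarrow> (\<forall>x\<in>S. \<forall>\<^sub>F (x', y) in uniformity. x' = x \<longrightarrow> y \<in> S)"

instance
proof
  fix s t u :: "('a, 'b) proj_tensor" and q r :: real
  show "s + t + u = s + (t + u)"
    by transfer (simp add: proj_Cauchy_add add.assoc)
  show "s + t = t + s"
    by transfer (simp add: proj_Cauchy_add add.commute)
  show "0 + t = t" by transfer simp
  show "- t + t = 0" unfolding uminus_proj_tensor_def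
    by transfer (use proj_Cauchy_scaleR[of _ "-1"] in auto)
  show "s - t = s + - t" by (simp add: uminus_proj_tensor_def minus_proj_tensor_def)
  show "r *\<^sub>R (s + t) = r *\<^sub>R s + r *\<^sub>R t"
    by transfer (simp add: proj_Cauchy_add proj_Cauchy_scaleR scaleR_add_right)
  show "(q + r) *\<^sub>R t = q *\<^sub>R t + r *\<^sub>R t"
    by transfer (simp add: proj_Cauchy_add proj_Cauchy_scaleR scaleR_add_left)
  show "q *\<^sub>R r *\<^sub>R t = (q * r) *\<^sub>R t"
    by transfer (simp add: proj_Cauchy_scaleR)
  show "1 *\<^sub>R t = t" by transfer simp
  show "dist s t = norm (s - t)" by (rule dist_proj_tensor_def)
  show "sgn t = inverse (norm t) *\<^sub>R t" by (rule sgn_proj_tensor_def)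
  show "(uniformity :: (('a, 'b) proj_tensor \<times> ('a, 'b) proj_tensor) filter) =
      (INF e\<in>{0 <..}. principal {(x, y). dist x y < e})"
    by (rule uniformity_proj_tensor_def)
  show "open S \<longleftrightarrow> (\<forall>x\<in>S. \<forall>\<^sub>F (x', y) in uniformity. x' = x \<longrightarrow> y \<in> S)"
    for S :: "('a, 'b) proj_tensor set"
    by (rule open_proj_tensor_def)
  show "norm t = 0 \<longleftrightarrow> t = 0"
  proof transfer
    fix t :: "nat \<Rightarrow> ('a, 'b) tensor"
    assume "proj_Cauchy t \<and> proj_Cauchy t \<and> (\<lambda>n. proj_norm (t n - t n)) \<longlonglongrightarrow> 0"
    then have *: "proj_Cauchy t" by simp
    then have "(\<lambda>n. proj_norm (t n)) \<longlonglongrightarrow> lim (\<lambda>n. proj_norm (t n))"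
      using proj_Cauchy_norm_convergent by (simp add: convergent_LIMSEQ_iff)
    then have "lim (\<lambda>n. proj_norm (t n)) = 0 \<longleftrightarrow> (\<lambda>n. proj_norm (t n)) \<longlonglongrightarrow> 0"
      by (metis LIMSEQ_unique)
    with * show "lim (\<lambda>n. proj_norm (t n)) = 0 \<longleftrightarrow>
        proj_Cauchy t \<and> proj_Cauchy (\<lambda>_. 0 :: ('a, 'b) tensor) \<and> (\<lambda>n. proj_norm (t n - 0)) \<longlonglongrightarrow> 0"
      by (simp only: diff_zero proj_Cauchy_const simp_thms)
  qed
  show "norm (s + t) \<le> norm s + norm t"
  proof transfer
    fix s t :: "nat \<Rightarrow> ('a, 'b) tensor"
    assume "proj_Cauchy s \<and> proj_Cauchy s \<and> (\<lambda>n. proj_norm (s n - s n)) \<longlonglongrightarrow> 0"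
      "proj_Cauchy t \<and> proj_Cauchy t \<and> (\<lambda>n. proj_norm (t n - t n)) \<longlonglongrightarrow> 0"
    then have *: "proj_Cauchy s" "proj_Cauchy t" by auto
    note lims = *[THEN proj_Cauchy_norm_convergent] proj_Cauchy_norm_convergent[OF proj_Cauchy_add[OF *]]
    show "lim (\<lambda>n. proj_norm (s n + t n)) \<le> lim (\<lambda>n. proj_norm (s n)) + lim (\<lambda>n. proj_norm (t n))"
      using lims unfolding convergent_LIMSEQ_iff
      by (intro LIMSEQ_le[OF _ tendsto_add]) (auto simp: proj_norm_triangle)
  qed
  show "norm (r *\<^sub>R t) = \<bar>r\<bar> * norm t"
  proof transfer
    fix r :: real and t :: "nat \<Rightarrow> ('a, 'b) tensor"
    assume "proj_Cauchy t \<and> proj_Cauchy t \<and> (\<lambda>n. proj_norm (t n - t n)) \<longlonglongrightarrow> 0"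
    then have "convergent (\<lambda>n. proj_norm (t n))" by (simp add: proj_Cauchy_norm_convergent)
    then show "lim (\<lambda>n. proj_norm (r *\<^sub>R t n)) = \<bar>r\<bar> * lim (\<lambda>n. proj_norm (t n))"
      unfolding convergent_LIMSEQ_iff proj_norm_scaleR by (intro limI tendsto_mult_left)
  qed
qed

end

definition proj_embed ::
  "('a::real_normed_vector, 'b::real_normed_vector) tensor \<Rightarrow> ('a, 'b) proj_tensor" where
  "proj_embed t = abs_proj_tensor (\<lambda>_. t)"

lemma norm_proj_embed: "norm (proj_embed t) = proj_norm t"
  by (simp add: proj_embed_def norm_proj_tensor.abs_eq limI)

lemma linear_proj_embed: "linear proj_embed"
  by (rule linearI)
     (simp_all add: proj_embed_def plus_proj_tensor.abs_eq scaleR_proj_tensor.abs_eq)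

lemma proj_embed_tendsto:
  assumes "proj_Cauchy s"
  shows "(\<lambda>n. proj_embed (s n)) \<longlonglongrightarrow> abs_proj_tensor s"
proof (rule LIMSEQ_I)
  fix e :: real assume e: "e > 0"
  then obtain N where N: "\<And>m n. m \<ge> N \<Longrightarrow> n \<ge> N \<Longrightarrow> proj_norm (s m - s n) < e / 2"
    using assms unfolding proj_Cauchy_def by (meson half_gt_zero)
  have "norm (proj_embed (s m) - abs_proj_tensor s) < e" if "m \<ge> N" for m
  proof -
    have C: "proj_Cauchy (\<lambda>n. s m + (-1) *\<^sub>R s n)"
      by (intro proj_Cauchy_add proj_Cauchy_scaleR assms proj_Cauchy_const)
    have "norm (proj_embed (s m) - abs_proj_tensor s) = lim (\<lambda>n. proj_norm (s m + (-1) *\<^sub>R s n))"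
      unfolding minus_proj_tensor_def proj_embed_def
      using assms C proj_Cauchy_scaleR[OF assms, of "-1"]
      by (simp only: scaleR_proj_tensor.abs_eq plus_proj_tensor.abs_eq norm_proj_tensor.abs_eq
          proj_Cauchy_const diff_self proj_norm_zero tendsto_const simp_thms)
    also have "\<dots> \<le> e / 2"
      using proj_Cauchy_norm_convergent[OF C] N[OF that] unfolding convergent_LIMSEQ_iff
      by (intro LIMSEQ_le_const2) (auto intro!: exI[of _ N] less_imp_le)
    finally show ?thesis using e by simp
  qed
  then show "\<exists>N. \<forall>m\<ge>N. norm (proj_embed (s m) - abs_proj_tensor s) < e" by blast
qed

lemma proj_embed_dense: "e > 0 \<Longrightarrow> \<exists>t. norm (proj_embed t - x) < e"
proof -
  assume e: "e > 0"
  obtain s where s: "proj_Cauchy s" "x = abs_proj_tensor s"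
    by (induction x rule: proj_tensor.abs_induct) blast
  show ?thesis using LIMSEQ_D[OF proj_embed_tendsto[OF s(1)] e] s(2) by blast
qed

instance proj_tensor :: (real_normed_vector, real_normed_vector) banach
proof
  fix X :: "nat \<Rightarrow> ('a, 'b) proj_tensor" assume X: "Cauchy X"
  have "\<exists>t. norm (proj_embed t - X n) < inverse (real (Suc n))" for n
    by (rule proj_embed_dense) simp
  then obtain t where t: "\<And>n. norm (proj_embed (t n) - X n) < inverse (real (Suc n))" by metis
  have null: "(\<lambda>n. proj_embed (t n) - X n) \<longlonglongrightarrow> 0"
    by (rule Lim_null_comparison[OF _ LIMSEQ_inverse_real_of_nat])
       (intro always_eventually allI less_imp_le t)
  have "Cauchy (\<lambda>n. proj_embed (t n))"
    unfolding Cauchy_iff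
  proof (intro allI impI)
    fix e :: real assume "e > 0"
    then have e: "e / 3 > 0" by simp
    from X e obtain M where M: "\<And>m n. m \<ge> M \<Longrightarrow> n \<ge> M \<Longrightarrow> norm (X m - X n) < e / 3"
      unfolding Cauchy_iff by metis
    from LIMSEQ_D[OF null e] obtain N where
      N: "\<And>n. n \<ge> N \<Longrightarrow> norm (proj_embed (t n) - X n) < e / 3" by auto
    have "norm (proj_embed (t m) - proj_embed (t n)) < e" if "m \<ge> max M N" "n \<ge> max M N" for m n
    proof -
      have "norm (proj_embed (t m) - proj_embed (t n)) \<le>
          norm (proj_embed (t m) - X m) + norm (X m - X n) + norm (proj_embed (t n) - X n)"
        using norm_triangle_ineq[of "proj_embed (t m) - X m" "X m - X n"]
          norm_triangle_ineq4[of "proj_embed (t m) - X n" "proj_embed (t n) - X n"]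
        by simp
      then show ?thesis using M[of m n] N[of m] N[of n] that by simp
    qed
    then show "\<exists>M. \<forall>m\<ge>M. \<forall>n\<ge>M. norm (proj_embed (t m) - proj_embed (t n)) < e" by blast
  qed
  then have "proj_Cauchy t"
    unfolding Cauchy_iff proj_Cauchy_def
    by (simp add: norm_proj_embed flip: linear_diff[OF linear_proj_embed])
  then have "(\<lambda>n. proj_embed (t n) - (proj_embed (t n) - X n)) \<longlonglongrightarrow> abs_proj_tensor t - 0"
    by (intro tendsto_diff proj_embed_tendsto null)
  then show "convergent X" by (auto simp: convergent_def)
qed

definition elem_tensor ::
  "'a::real_normed_vector \<Rightarrow> 'b::real_normed_vector \<Rightarrow> ('a, 'b) proj_tensor"
  (infixr "\<otimes>\<^sub>\<pi>" 75) where
  "x \<otimes>\<^sub>\<pi> y = proj_embed (abs_tensor [(x, y)])"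

section \<open>The symmetric projective tensor product\<close>

definition sym_subspace :: "('a::real_normed_vector, 'a) proj_tensor set" where
  "sym_subspace = closure (span (range (\<lambda>u. u \<otimes>\<^sub>\<pi> u)))"

lemma sym_square_in: "u \<otimes>\<^sub>\<pi> u \<in> sym_subspace"
  unfolding sym_subspace_def by (intro subsetD[OF closure_subset] span_base rangeI)

lemma subspace_sym_subspace: "subspace sym_subspace"
  unfolding sym_subspace_def
proof (rule subspaceI)
  let ?S = "span (range (\<lambda>u. u \<otimes>\<^sub>\<pi> u)) :: ('a, 'a) proj_tensor set"
  show "0 \<in> closure ?S" by (intro subsetD[OF closure_subset] span_zero)
  show "x + y \<in> closure ?S" if xy: "x \<in> closure ?S" "y \<in> closure ?S" for x y
  proof -
    obtain f g where fg: "\<And>n. f n \<in> ?S" "f \<longlonglongrightarrow> x" "\<And>n. g n \<in> ?S" "g \<longlonglongrightarrow> y"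
      using xy unfolding closure_sequential by blast
    show ?thesis unfolding closure_sequential
      by (rule exI[of _ "\<lambda>n. f n + g n"]) (auto intro: span_add tendsto_add fg)
  qed
  show "c *\<^sub>R x \<in> closure ?S" if x: "x \<in> closure ?S" for c x
  proof -
    obtain f where f: "\<And>n. f n \<in> ?S" "f \<longlonglongrightarrow> x"
      using x unfolding closure_sequential by blast
    show ?thesis unfolding closure_sequential
      by (rule exI[of _ "\<lambda>n. c *\<^sub>R f n"]) (auto intro: span_scale tendsto_scaleR f)
  qed
qed

typedef (overloaded) 'a sym_tensor = "sym_subspace :: ('a::real_normed_vector, 'a) proj_tensor set"
  using sym_square_in by blast

setup_lifting type_definition_sym_tensor

instantiation sym_tensor :: (real_normed_vector) real_normed_vector
begin

lift_definition zero_sym_tensor :: "'a sym_tensor" is 0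
  by (rule subspace_0[OF subspace_sym_subspace])

lift_definition plus_sym_tensor :: "'a sym_tensor \<Rightarrow> 'a sym_tensor \<Rightarrow> 'a sym_tensor" is "(+)"
  by (rule subspace_add[OF subspace_sym_subspace])

lift_definition minus_sym_tensor :: "'a sym_tensor \<Rightarrow> 'a sym_tensor \<Rightarrow> 'a sym_tensor" is "(-)"
  by (rule subspace_diff[OF subspace_sym_subspace])

lift_definition uminus_sym_tensor :: "'a sym_tensor \<Rightarrow> 'a sym_tensor" is uminus
  by (rule subspace_neg[OF subspace_sym_subspace])

lift_definition scaleR_sym_tensor :: "real \<Rightarrow> 'a sym_tensor \<Rightarrow> 'a sym_tensor" is scaleR
  by (rule subspace_scale[OF subspace_sym_subspace])

lift_definition norm_sym_tensor :: "'a sym_tensor \<Rightarrow> real" is norm .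

definition dist_sym_tensor :: "'a sym_tensor \<Rightarrow> 'a sym_tensor \<Rightarrow> real" where
  "dist_sym_tensor s t = norm (s - t)"

definition sgn_sym_tensor :: "'a sym_tensor \<Rightarrow> 'a sym_tensor" where
  "sgn_sym_tensor t = inverse (norm t) *\<^sub>R t"

definition uniformity_sym_tensor :: "('a sym_tensor \<times> 'a sym_tensor) filter" where
  "uniformity_sym_tensor = (INF e\<in>{0 <..}. principal {(x, y). dist x y < e})"

definition open_sym_tensor :: "'a sym_tensor set \<Rightarrow> bool" where
  "open_sym_tensor S \<longleftrightarrow> (\<forall>x\<in>S. \<forall>\<^sub>F (x', y) in uniformity. x' = x \<longrightarrow> y \<in> S)"

instance
proof
  fix s t u :: "'a sym_tensor" and q r :: real
  show "s + t + u = s + (t + u)" by transfer simp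
  show "s + t = t + s" by transfer simp
  show "0 + t = t" by transfer simp
  show "- t + t = 0" by transfer simp
  show "s - t = s + - t" by transfer simp
  show "r *\<^sub>R (s + t) = r *\<^sub>R s + r *\<^sub>R t" by transfer (rule scaleR_add_right)
  show "(q + r) *\<^sub>R t = q *\<^sub>R t + r *\<^sub>R t" by transfer (rule scaleR_add_left)
  show "q *\<^sub>R r *\<^sub>R t = (q * r) *\<^sub>R t" by transfer simp
  show "1 *\<^sub>R t = t" by transfer simp
  show "dist s t = norm (s - t)" by (rule dist_sym_tensor_def)
  show "sgn t = inverse (norm t) *\<^sub>R t" by (rule sgn_sym_tensor_def)
  show "(uniformity :: ('a sym_tensor \<times> 'a sym_tensor) filter) =
      (INF e\<in>{0 <..}. principal {(x, y). dist x y < e})"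
    by (rule uniformity_sym_tensor_def)
  show "open S \<longleftrightarrow> (\<forall>x\<in>S. \<forall>\<^sub>F (x', y) in uniformity. x' = x \<longrightarrow> y \<in> S)"
    for S :: "'a sym_tensor set"
    by (rule open_sym_tensor_def)
  show "norm t = 0 \<longleftrightarrow> t = 0" by transfer simp
  show "norm (s + t) \<le> norm s + norm t" by transfer (rule norm_triangle_ineq)
  show "norm (r *\<^sub>R t) = \<bar>r\<bar> * norm t" by transfer simp
qed

end

lift_definition sym_square :: "'a::real_normed_vector \<Rightarrow> 'a sym_tensor" is "\<lambda>u. u \<otimes>\<^sub>\<pi> u"
  by (rule sym_square_in)

section \<open>Dilinear mappings and diconvex functionals\<close>

text \<open>The library's norm on a product type is the Euclidean combination of the norms of the factors;
  boundedness does not depend on this choice.\<close>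

definition dilinear :: "('a::real_normed_vector \<Rightarrow> 'b::real_normed_vector) \<Rightarrow> bool" where
  "dilinear K \<longleftrightarrow>
    (\<exists>L :: 'a \<times> 'a sym_tensor \<Rightarrow> 'b. linear L \<and> (\<forall>u. K u = L (u, sym_square u)))"

definition bounded_dilinear :: "('a::real_normed_vector \<Rightarrow> 'b::real_normed_vector) \<Rightarrow> bool" where
  "bounded_dilinear K \<longleftrightarrow>
    (\<exists>L :: 'a \<times> 'a sym_tensor \<Rightarrow> 'b. bounded_linear L \<and> (\<forall>u. K u = L (u, sym_square u)))"

definition proper :: "('a \<Rightarrow> ereal) \<Rightarrow> bool" where
  "proper F \<longleftrightarrow> (\<forall>x. F x \<noteq> -\<infinity>) \<and> (\<exists>x. F x \<noteq> \<infinity>)"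

text \<open>The right-hand side never involves the undetermined sum of opposite infinities, since this
  notion is only used for proper functionals; for \<open>t = 0\<close> and \<open>t = 1\<close> the inequality is trivial
  because \<open>0 * \<infinity> = 0\<close> in \<^typ>\<open>ereal\<close>.\<close>

definition convex_functional :: "('a::real_vector \<Rightarrow> ereal) \<Rightarrow> bool" where
  "convex_functional F \<longleftrightarrow>
    (\<forall>x y. \<forall>t\<in>{0..1}. F ((1 - t) *\<^sub>R x + t *\<^sub>R y) \<le> ereal (1 - t) * F x + ereal t * F y)"

definition diconvex :: "('a::real_normed_vector \<Rightarrow> ereal) \<Rightarrow> bool" where
  "diconvex F \<longleftrightarrow>
    (\<exists>G :: 'a \<times> 'a sym_tensor \<Rightarrow> ereal.
      proper G \<and> convex_functional G \<and> (\<forall>u. F u = G (u, sym_square u)))"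

section \<open>Preduals and weak* notions\<close>

text \<open>A predual of \<open>'x\<close> is a Banach space \<open>'p\<close> together with an isometric isomorphism \<open>D\<close> of
  \<open>'x\<close> onto the dual of \<open>'p\<close>.\<close>

definition is_predual :: "('x::banach \<Rightarrow> 'p::banach \<Rightarrow>\<^sub>L real) \<Rightarrow> bool" where
  "is_predual D \<longleftrightarrow> linear D \<and> bij D \<and> (\<forall>u. norm (D u) = norm u)"

text \<open>On real-valued bounded functionals, the strong operator topology is the topology of pointwise
  convergence, that is, the weak* topology.\<close>

definition weak_star :: "('x::banach \<Rightarrow> 'p::banach \<Rightarrow>\<^sub>L real) \<Rightarrow> 'x topology" where
  "weak_star D = pullback_topology UNIV D strong_operator_topology"

lemma limitin_pullback_UNIV:
  "limitin (pullback_topology UNIV h T) f l F \<longleftrightarrow> limitin T (\<lambda>i. h (f i)) (h l) F"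
proof
  assume L: "limitin (pullback_topology UNIV h T) f l F"
  show "limitin T (\<lambda>i. h (f i)) (h l) F"
    unfolding limitin_def
  proof (intro conjI allI impI)
    show "h l \<in> topspace T"
      using limitin_topspace[OF L] by (simp add: topspace_pullback_topology)
    fix U assume U: "openin T U \<and> h l \<in> U"
    have "openin (pullback_topology UNIV h T) (h -` U)"
      using U by (auto simp: openin_pullback_topology)
    then have "\<forall>\<^sub>F i in F. f i \<in> h -` U"
      using limitinD[OF L] U by blast
    then show "\<forall>\<^sub>F i in F. h (f i) \<in> U" by simp
  qed
next
  assume L: "limitin T (\<lambda>i. h (f i)) (h l) F"
  show "limitin (pullback_topology UNIV h T) f l F"
    unfolding limitin_def
  proof (intro conjI allI impI)
    show "l \<in> topspace (pullback_topology UNIV h T)"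
      using limitin_topspace[OF L] by (simp add: topspace_pullback_topology)
    fix V assume V: "openin (pullback_topology UNIV h T) V \<and> l \<in> V"
    then obtain U where U: "openin T U" "V = h -` U" by (auto simp: openin_pullback_topology)
    then have "\<forall>\<^sub>F i in F. h (f i) \<in> U" using L V by (simp add: limitin_def)
    then show "\<forall>\<^sub>F i in F. f i \<in> V" using U by simp
  qed
qed

lemma limitin_weak_star_iff:
  "limitin (weak_star D) f u F \<longleftrightarrow>
    (\<forall>\<phi>. ((\<lambda>i. blinfun_apply (D (f i)) \<phi>) \<longlongrightarrow> blinfun_apply (D u) \<phi>) F)"
  unfolding weak_star_def strong_operator_topology_def limitin_pullback_UNIV
    euclidean_product_topology[symmetric] limitin_componentwise by simp

definition reflexive_space :: "'p::banach itself \<Rightarrow> bool" where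
  "reflexive_space _ \<longleftrightarrow>
    (\<forall>\<Phi> :: ('p \<Rightarrow>\<^sub>L real) \<Rightarrow>\<^sub>L real. \<exists>x :: 'p. \<forall>\<phi>. blinfun_apply \<Phi> \<phi> = blinfun_apply \<phi> x)"

definition seq_continuous :: "'a topology \<Rightarrow> 'b topology \<Rightarrow> ('a \<Rightarrow> 'b) \<Rightarrow> bool" where
  "seq_continuous S T f \<longleftrightarrow>
    (\<forall>x l. limitin S x l sequentially \<longrightarrow> limitin T (\<lambda>n. f (x n)) (f l) sequentially)"

definition seq_lower_semicontinuous :: "'a topology \<Rightarrow> ('a \<Rightarrow> ereal) \<Rightarrow> bool" where
  "seq_lower_semicontinuous S F \<longleftrightarrow>
    (\<forall>x l. limitin S x l sequentially \<longrightarrow> F l \<le> liminf (\<lambda>n. F (x n)))"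

definition H_property :: "('x::banach \<Rightarrow> 'p::banach \<Rightarrow>\<^sub>L real) \<Rightarrow> ('x \<Rightarrow> ereal) \<Rightarrow> bool" where
  "H_property D R \<longleftrightarrow>
    (\<forall>x l. limitin (weak_star D) x l sequentially \<and> (\<lambda>n. R (x n)) \<longlonglongrightarrow> R l \<longrightarrow> x \<longlonglongrightarrow> l)"

section \<open>Tikhonov functionals\<close>

definition Tikhonov ::
  "('x \<Rightarrow> 'y::real_normed_vector) \<Rightarrow> ('x \<Rightarrow> ereal) \<Rightarrow> real \<Rightarrow> real \<Rightarrow> 'y \<Rightarrow> 'x \<Rightarrow> ereal" where
  "Tikhonov K R p \<alpha> g u = ereal (norm (K u - g) powr p) + ereal \<alpha> * R u"

definition minimizer :: "('x \<Rightarrow> ereal) \<Rightarrow> 'x \<Rightarrow> bool" where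
  "minimizer F u \<longleftrightarrow> (\<forall>v. F u \<le> F v)"

end

theory Submission
  imports Defs "HOL-Complex_Analysis.Great_Picard"
begin

text \<open>The values of \<open>J\<close> at the minimizers \<open>u\<^sub>n\<close> are bounded, so by coercivity \<open>(u\<^sub>n)\<close> is bounded and has a
  weak* convergent subsequence: for a separable predual by a diagonal argument, for a reflexive one
  by the argument behind the Eberlein-Smulian theorem, with Hahn-Banach obtained from minimal
  sublinear functionals. Weak* lower semi-continuity of the norm and of \<open>R\<close> makes the limit a
  minimizer, and the convergence of the minimal values forces \<open>R(u\<^sub>n) \<rightarrow> R(u)\<close> along the subsequence,
  which is what the H-property asks for.\<close>

section \<open>Sublinear functionals\<close>

text \<open>Boundedness alone yields weak* compactness but not weak* sequential compactness; this is
  where the alternative on the predual enters. If \<open>'xp\<close> is reflexive but not separable,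
  no countable set of test vectors decides convergence of bounded sequences on all of
  \<open>'xp\<close>. What is countable is the range of the given sequence: its span is separable,
  and by reflexivity vectors that norm this span separate the possible limits. On the variational
  side the data move with n while coercivity is assumed only at the limit data, so the bounds are
  transferred by the triangle inequality, and lower semi-continuity is proved jointly in data and
  argument. No existence theorem for minimizers enters: a minimizer for the limit data arises as a
  limit of the given ones.\<close>

definition sublinear :: "('a::real_vector \<Rightarrow> real) \<Rightarrow> bool" where
  "sublinear p \<longleftrightarrow>
    (\<forall>x y. p (x + y) \<le> p x + p y) \<and> (\<forall>c x. 0 \<le> c \<longrightarrow> p (c *\<^sub>R x) = c * p x)"

lemma sublinearD:
  assumes "sublinear p"
  shows "p (x + y) \<le> p x + p y" "0 \<le> c \<Longrightarrow> p (c *\<^sub>R x) = c * p x" "p 0 = 0" "- p (- x) \<le> p x"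
proof -
  show add: "p (x + y) \<le> p x + p y" and scale: "0 \<le> c \<Longrightarrow> p (c *\<^sub>R x) = c * p x" for x y c
    using assms by (auto simp: sublinear_def)
  show "p 0 = 0" using scale[of 0 0] by simp
  then show "- p (- x) \<le> p x" using add[of x "- x"] by simp
qed

text \<open>An upper bound for positive factors suffices, since the factor \<open>inverse c\<close>
  gives the reverse inequality. At 0, subadditivity yields \<open>p 0 \<ge> 0\<close> and halving
  yields \<open>p 0 \<le> 0\<close>.\<close>

lemma sublinearI:
  assumes add: "\<And>x y. p (x + y) \<le> p x + p y"
    and scale: "\<And>c x. 0 < c \<Longrightarrow> p (c *\<^sub>R x) \<le> c * p x"
  shows "sublinear p"
  unfolding sublinear_def
proof (intro conjI allI impI add)
  have p0: "p 0 = 0"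
    using add[of 0 0] scale[of "1/2" 0] by simp
  fix c :: real and x assume "0 \<le> c"
  show "p (c *\<^sub>R x) = c * p x"
  proof (cases "c = 0")
    case False
    with \<open>0 \<le> c\<close> have "0 < c" by simp
    have "p (inverse c *\<^sub>R (c *\<^sub>R x)) \<le> inverse c * p (c *\<^sub>R x)"
      by (rule scale) (use \<open>0 < c\<close> in simp)
    then have "c * p x \<le> p (c *\<^sub>R x)"
      using \<open>0 < c\<close> by (simp add: field_simps)
    with scale[OF \<open>0 < c\<close>] show ?thesis by (metis antisym)
  qed (simp add: p0)
qed

text \<open>Oddness turns subadditivity at \<open>- x\<close> and \<open>- y\<close> into
  superadditivity at \<open>x\<close> and \<open>y\<close>, and reduces negative factors to positive
  ones.\<close>

lemma sublinear_odd_imp_linear: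
  assumes "sublinear p" and odd: "\<And>x. p (- x) = - p x"
  shows "linear p"
proof (rule linearI)
  note D = sublinearD[OF assms(1)]
  show "p (x + y) = p x + p y" for x y
    using D(1)[of x y] D(1)[of "- x" "- y"] odd[of x] odd[of y] odd[of "x + y"]
    by (simp add: add.commute)
  show "p (c *\<^sub>R x) = c *\<^sub>R p x" for c x
    using D(2)[of c x] D(2)[of "- c" x] odd[of "c *\<^sub>R x"] by (cases "0 \<le> c") auto
qed

text \<open>The witness is \<open>q x = inf\<^bsub>t\<ge>0\<^esub> (p (x + t v) - t p v)\<close>. A minimal sublinear functional thus
  satisfies \<open>m (- v) \<le> - m v\<close> for all \<open>v\<close>, so that it is linear.\<close>

lemma sublinear_below:
  assumes "sublinear p"
  obtains q where "sublinear q" "q \<le> p" "q (- v) \<le> - p v"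
proof
  note D = sublinearD[OF assms]
  define S where "S x = (\<lambda>t. p (x + t *\<^sub>R v) - t * p v) ` {0..}" for x
  define q where "q x = Inf (S x)" for x
  \<comment> \<open>As \<open>t *\<^sub>R v\<close> is the sum of \<open>x + t *\<^sub>R v\<close>
    and \<open>- x\<close>, subtracting \<open>t * p v\<close> costs at most
    \<open>p (- x)\<close>.\<close>
  have bdd: "bdd_below (S x)" for x
  proof (rule bdd_belowI)
    fix y assume "y \<in> S x"
    then obtain t where t: "0 \<le> t" "y = p (x + t *\<^sub>R v) - t * p v" by (auto simp: S_def)
    have "t * p v \<le> p (x + t *\<^sub>R v) + p (- x)"
      using D(1)[of "x + t *\<^sub>R v" "- x"] D(2)[OF t(1), of v] by simp
    then show "- p (- x) \<le> y" using t by simp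
  qed
  have le: "q x \<le> p (x + t *\<^sub>R v) - t * p v" if "0 \<le> t" for x t
    unfolding q_def by (rule cInf_lower[OF _ bdd]) (use that in \<open>auto simp: S_def\<close>)
  have greatest: "c \<le> q x" if "\<And>t. 0 \<le> t \<Longrightarrow> c \<le> p (x + t *\<^sub>R v) - t * p v" for c x
    unfolding q_def by (rule cInf_greatest) (use that in \<open>auto simp: S_def\<close>)
  \<comment> \<open>The parameter 0 gives domination by \<open>p\<close>; the parameter 1 moves the
    argument \<open>- v\<close> to 0.\<close>
  show "q \<le> p" using le[of 0] by (auto simp: le_fun_def)
  show "q (- v) \<le> - p v" using le[of 1 "- v"] D(3) by simp
  show "sublinear q"
  proof (rule sublinearI)
    fix x y
    \<comment> \<open>Parameters add up: shifting \<open>x\<close> by \<open>s *\<^sub>R v\<close>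
      and \<open>y\<close> by \<open>t *\<^sub>R v\<close> shifts the sum by
      \<open>(s + t) *\<^sub>R v\<close>.\<close>
    have "q (x + y) \<le> (p (x + s *\<^sub>R v) - s * p v) + (p (y + t *\<^sub>R v) - t * p v)"
      if "0 \<le> s" "0 \<le> t" for s t
      using le[of "s + t" "x + y"] D(1)[of "x + s *\<^sub>R v" "y + t *\<^sub>R v"] that
      by (simp add: algebra_simps)
    then have "q (x + y) - (p (y + t *\<^sub>R v) - t * p v) \<le> q x" if "0 \<le> t" for t
      using that by (intro greatest) (simp add: diff_le_eq)
    then have "q (x + y) - q x \<le> q y"
      by (intro greatest) (simp add: algebra_simps)
    then show "q (x + y) \<le> q x + q y" by simp
  next
    fix c :: real and x assume c: "0 < c"
    have "q (c *\<^sub>R x) / c \<le> q x"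
    proof (rule greatest)
      fix t :: real assume "0 \<le> t"
      then have "q (c *\<^sub>R x) \<le> p (c *\<^sub>R (x + t *\<^sub>R v)) - c * t * p v"
        using le[of "c * t" "c *\<^sub>R x"] c by (simp add: scaleR_add_right)
      also have "\<dots> = c * (p (x + t *\<^sub>R v) - t * p v)"
        using D(2)[of c "x + t *\<^sub>R v"] c by (simp add: right_diff_distrib)
      finally show "q (c *\<^sub>R x) / c \<le> p (x + t *\<^sub>R v) - t * p v"
        using c by (simp add: field_simps)
    qed
    then show "q (c *\<^sub>R x) \<le> c * q x" using c by (simp add: field_simps)
  qed
qed

text \<open>Zorn's lemma for the reversed pointwise order. Every sublinear \<open>q\<close> below
  \<open>p\<close> satisfies \<open>q x \<ge> - p (- x)\<close>, so nonempty chains have finite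
  pointwise infima.\<close>

lemma minimal_sublinear_exists:
  assumes "sublinear p"
  obtains m where "sublinear m" "m \<le> p" "\<And>q. sublinear q \<Longrightarrow> q \<le> m \<Longrightarrow> q = m"
proof -
  let ?A = "{q. sublinear q \<and> q \<le> p}"
  have "\<exists>m\<in>?A. \<forall>q\<in>?A. m \<ge> q \<longrightarrow> q = m"
  proof (rule predicate_Zorn)
    show "partial_order_on ?A (relation_of (\<lambda>a b. a \<ge> b) ?A)"
      by (rule partial_order_on_relation_ofI) auto
    fix C assume C: "C \<in> Chains (relation_of (\<lambda>a b. a \<ge> b) ?A)"
    then have CA: "C \<subseteq> ?A" by (rule Chains_relation_of)
    show "\<exists>u\<in>?A. \<forall>a\<in>C. u \<le> a"
    proof (cases "C = {}")
      case False
      define h where "h x = (INF q\<in>C. q x)" for x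
      have "- p (- x) \<le> q x" if "q \<in> C" for q x
      proof -
        have "sublinear q" "q (- x) \<le> p (- x)" using CA that by (auto simp: le_fun_def)
        then show ?thesis using sublinearD(4)[of q x] by linarith
      qed
      then have bdd: "bdd_below ((\<lambda>q. q x) ` C)" for x by (intro bdd_belowI2)
      have le: "h x \<le> q x" if "q \<in> C" for q x
        unfolding h_def by (rule cINF_lower[OF bdd that])
      have greatest: "c \<le> h x" if "\<And>q. q \<in> C \<Longrightarrow> c \<le> q x" for c x
        unfolding h_def by (rule cINF_greatest[OF False that])
      have "sublinear h"
      proof (rule sublinearI)
        fix x y
        have "h (x + y) \<le> q x + r y" if qr: "q \<in> C" "r \<in> C" for q r
        proof -
          \<comment> \<open>Subadditivity of the infimum rests on the chain condition: the smaller
            of two members serves both arguments.\<close>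
          have "q \<le> r \<or> r \<le> q"
            using C qr by (auto simp: Chains_def relation_of_def)
          then obtain s where "s \<in> C" "s \<le> q" "s \<le> r" using qr by auto
          then have "h (x + y) \<le> s x + s y" "s x \<le> q x" "s y \<le> r y"
            using le[of s "x + y"] CA sublinearD(1)[of s x y] by (auto simp: le_fun_def)
          then show ?thesis by simp
        qed
        then have "h (x + y) - r y \<le> h x" if "r \<in> C" for r
          using that by (intro greatest) (simp add: diff_le_eq)
        then have "h (x + y) - h x \<le> h y"
          by (intro greatest) (simp add: algebra_simps)
        then show "h (x + y) \<le> h x + h y" by simp
      next
        fix c :: real and x assume c: "0 < c"
        have "h (c *\<^sub>R x) / c \<le> h x"
        proof (rule greatest)
          fix q assume "q \<in> C"
          then have "h (c *\<^sub>R x) \<le> c * q x"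
            using le[of q "c *\<^sub>R x"] CA sublinearD(2)[of q c x] c by auto
          then show "h (c *\<^sub>R x) / c \<le> q x" using c by (simp add: field_simps)
        qed
        then show "h (c *\<^sub>R x) \<le> c * h x" using c by (simp add: field_simps)
      qed
      moreover have "h \<le> p"
        using False CA le unfolding le_fun_def by (smt (verit) ex_in_conv le_fun_def mem_Collect_eq subsetD)
      ultimately show ?thesis using le by (auto simp: le_fun_def intro!: bexI[of _ h])
    qed (use assms in auto)
  qed
  then obtain m where "m \<in> ?A" "\<forall>q\<in>?A. q \<le> m \<longrightarrow> q = m" by auto
  then show thesis using that[of m] by (auto intro: order_trans)
qed

text \<open>Minimizing below \<open>q\<close> instead of \<open>p\<close> builds
  \<open>m (- v) \<le> - p v\<close> into \<open>m\<close>, which oddness turns into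
  \<open>p v \<le> m v\<close>. Oddness holds because a functional below \<open>m\<close> with value
  at most \<open>- m x\<close> at \<open>- x\<close> must be \<open>m\<close> itself.\<close>

lemma hahn_banach_sublinear:
  assumes "sublinear p"
  obtains f where "linear f" "f \<le> p" "f v = p v"
proof -
  obtain q where q: "sublinear q" "q \<le> p" "q (- v) \<le> - p v"
    using sublinear_below[OF assms] .
  obtain m where m: "sublinear m" "m \<le> q" and min: "\<And>r. sublinear r \<Longrightarrow> r \<le> m \<Longrightarrow> r = m"
    using minimal_sublinear_exists[OF q(1)] by blast
  have "m (- x) = - m x" for x
  proof -
    obtain r where "sublinear r" "r \<le> m" "r (- x) \<le> - m x"
      using sublinear_below[OF m(1)] .
    then have "m (- x) \<le> - m x" using min by blast
    then show ?thesis using sublinearD(4)[OF m(1), of x] by simp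
  qed
  then have "linear m" by (rule sublinear_odd_imp_linear[OF m(1)])
  moreover have "m \<le> p" using m(2) q(2) by (rule order_trans)
  moreover have "m v = p v"
  proof (rule antisym)
    show "m v \<le> p v" using \<open>m \<le> p\<close> by (simp add: le_fun_def)
    have "m (- v) \<le> - p v" using m(2) q(3) by (meson le_funD order_trans)
    then show "p v \<le> m v" using \<open>linear m\<close> by (simp add: linear_neg)
  qed
  ultimately show thesis by (rule that)
qed

section \<open>Separation from a subspace in the dual of a reflexive space\<close>

lemma linear_le_norm_imp_bounded_linear:
  fixes f :: "'a::real_normed_vector \<Rightarrow> real"
  assumes "linear f" "\<And>x. f x \<le> C * norm x"
  shows "bounded_linear f"
proof -
  interpret linear f by fact
  have "\<bar>f x\<bar> \<le> norm x * C" for x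
    using assms(2)[of x] assms(2)[of "- x"] by (simp add: neg abs_le_iff mult.commute)
  then show ?thesis
    by (intro bounded_linear_intro[where K = C]) (auto simp: add scale)
qed

text \<open>This distance is the quotient seminorm modulo \<open>S\<close>: sums and multiples of
  approximating points of \<open>S\<close> are again admissible.\<close>

lemma sublinear_infdist:
  fixes S :: "'a::real_normed_vector set"
  assumes "subspace S"
  shows "sublinear (\<lambda>x. infdist x S)"
proof -
  have ne: "S \<noteq> {}" using subspace_0[OF assms] by auto
  have greatest: "c \<le> infdist x S" if "\<And>a. a \<in> S \<Longrightarrow> c \<le> dist x a" for c x
    unfolding infdist_notempty[OF ne] using ne that by (rule cINF_greatest)
  show ?thesis
  proof (rule sublinearI)
    fix x y
    have "infdist (x + y) S \<le> dist x a + dist y b" if "a \<in> S" "b \<in> S" for a b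
      using infdist_le[of "a + b" S "x + y"] subspace_add[OF assms that] dist_triangle_add[of x y a b]
      by simp
    then have "infdist (x + y) S - dist y b \<le> infdist x S" if "b \<in> S" for b
      using that by (intro greatest) (simp add: diff_le_eq)
    then have "infdist (x + y) S - infdist x S \<le> infdist y S"
      by (intro greatest) (simp add: algebra_simps)
    then show "infdist (x + y) S \<le> infdist x S + infdist y S" by simp
  next
    fix c :: real and x assume c: "0 < c"
    have "infdist (c *\<^sub>R x) S / c \<le> infdist x S"
    proof (rule greatest)
      fix a assume "a \<in> S"
      then have "infdist (c *\<^sub>R x) S \<le> dist (c *\<^sub>R x) (c *\<^sub>R a)"
        using assms by (intro infdist_le) (auto intro: subspace_scale)
      also have "\<dots> = c * dist x a" using c by (simp add: dist_norm flip: scaleR_diff_right)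
      finally show "infdist (c *\<^sub>R x) S / c \<le> dist x a" using c by (simp add: field_simps)
    qed
    then show "infdist (c *\<^sub>R x) S \<le> c * infdist x S" using c by (simp add: field_simps)
  qed
qed

text \<open>Hahn-Banach in the dual, dominated by the distance to \<open>S\<close>, gives a functional that vanishes on
  \<open>S\<close>; by reflexivity it is the evaluation at a point.\<close>

lemma reflexive_annihilator:
  fixes S :: "('p::banach \<Rightarrow>\<^sub>L real) set"
  assumes refl: "reflexive_space TYPE('p)" and S: "subspace S"
    and ann: "\<And>x. (\<And>\<psi>. \<psi> \<in> S \<Longrightarrow> blinfun_apply \<psi> x = 0) \<Longrightarrow> blinfun_apply \<phi> x = 0"
  shows "\<phi> \<in> closure S"
proof -
  obtain F where F: "linear F" "F \<le> (\<lambda>\<psi>. infdist \<psi> S)" "F \<phi> = infdist \<phi> S"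
    using hahn_banach_sublinear[OF sublinear_infdist[OF S]] .
  have le: "F \<psi> \<le> infdist \<psi> S" for \<psi> using F(2) by (simp add: le_fun_def)
  have "infdist \<psi> S \<le> 1 * norm \<psi>" for \<psi>
    using infdist_le[OF subspace_0[OF S], of \<psi>] by simp
  then have "bounded_linear F"
    using F(1) le by (intro linear_le_norm_imp_bounded_linear[where C = 1]) (auto intro: order_trans)
  then obtain x where x: "\<And>\<psi>. F \<psi> = blinfun_apply \<psi> x"
    using refl unfolding reflexive_space_def by (metis bounded_linear_Blinfun_apply)
  have "blinfun_apply \<psi> x = 0" if "\<psi> \<in> S" for \<psi>
    using le[of \<psi>] le[of "- \<psi>"] that subspace_neg[OF S that] linear_neg[OF F(1), of \<psi>]
    by (simp add: x)
  \<comment> \<open>At \<open>\<phi>\<close> the functional attains the whole distance, while its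
    representing point \<open>x\<close> is annihilated by \<open>S\<close> and hence by
    \<open>\<phi>\<close>.\<close>
  then have "infdist \<phi> S = 0" using ann F(3) x by simp
  moreover have "S \<noteq> {}" using subspace_0[OF S] by auto
  ultimately show ?thesis by (simp add: in_closure_iff_infdist_zero)
qed

text \<open>Lists of rational coefficients paired with vectors encode the rational combinations, so
  countability is inherited from lists.\<close>

lemma countable_dense_in_span:
  fixes S :: "'a::real_normed_vector set"
  assumes "countable S"
  obtains Q where "countable Q" "span S \<subseteq> closure Q"
proof -
  define comb where "comb = (\<lambda>l :: (rat \<times> 'a) list. \<Sum>(q, x)\<leftarrow>l. (of_rat q :: real) *\<^sub>R x)"
  define Q where "Q = comb ` lists (UNIV \<times> S)"
  have append: "comb (l @ l') = comb l + comb l'" for l l' by (simp add: comb_def)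
  have scale: "comb (map (\<lambda>(q, x). (r * q, x)) l) = of_rat r *\<^sub>R comb l" for r l
    by (induction l) (auto simp: comb_def of_rat_mult scaleR_add_right)
  have Q_add: "x + y \<in> Q" if "x \<in> Q" "y \<in> Q" for x y
    proof -
    obtain l l' where "l \<in> lists (UNIV \<times> S)" "x = comb l" "l' \<in> lists (UNIV \<times> S)" "y = comb l'"
      using \<open>x \<in> Q\<close> \<open>y \<in> Q\<close> by (auto simp: Q_def)
    then show ?thesis unfolding Q_def by (intro image_eqI[of _ _ "l @ l'"]) (auto simp: append)
  qed
  have Q_scale: "of_rat r *\<^sub>R x \<in> Q" if x: "x \<in> Q" for r x
  proof -
    obtain l where l: "l \<in> lists (UNIV \<times> S)" "x = comb l" using x by (auto simp: Q_def)
    then have "map (\<lambda>(q, x). (r * q, x)) l \<in> lists (UNIV \<times> S)" by (auto simp: in_lists_conv_set)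
    then show ?thesis unfolding Q_def l(2) scale[symmetric] by (rule imageI)
  qed
  have "countable Q" unfolding Q_def by (intro countable_image countable_lists) (use assms in auto)
  moreover have "span S \<subseteq> closure Q"
  proof (rule span_minimal)
    have "x \<in> Q" if "x \<in> S" for x
      using that unfolding Q_def by (intro image_eqI[of _ _ "[(1, x)]"]) (auto simp: comb_def)
    then show "S \<subseteq> closure Q" using closure_subset by blast
    show "subspace (closure Q)"
      unfolding subspace_def
    proof (intro conjI ballI allI)
      have "comb [] \<in> Q" by (auto simp: Q_def)
      then show "0 \<in> closure Q" using closure_subset by (auto simp: comb_def)
      show "x + y \<in> closure Q" if xy: "x \<in> closure Q" "y \<in> closure Q" for x y
      proof -
        obtain a b where "\<And>n. a n \<in> Q" "a \<longlonglongrightarrow> x" "\<And>n. b n \<in> Q" "b \<longlonglongrightarrow> y"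
          using xy unfolding closure_sequential by blast
        then show ?thesis unfolding closure_sequential
          by (intro exI[of _ "\<lambda>n. a n + b n"]) (auto intro: Q_add tendsto_add)
      qed
      show "c *\<^sub>R x \<in> closure Q" if x: "x \<in> closure Q" for c x
      proof -
        obtain a where a: "\<And>n. a n \<in> Q" "a \<longlonglongrightarrow> x"
          using x unfolding closure_sequential by blast
        \<comment> \<open>For a real factor, scalar and vector are approximated together, since only
          rational multiples stay in \<open>Q\<close>.\<close>
        have "c \<in> closure \<rat>" by (simp add: Rats_closure_real)
        then obtain r where r: "\<And>n. r n \<in> \<rat>" "r \<longlonglongrightarrow> c"
          unfolding closure_sequential by blast
        have "r n *\<^sub>R a n \<in> Q" for n
          using r(1)[of n] Q_scale[OF a(1)] by (auto elim: Rats_cases)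
        then show ?thesis unfolding closure_sequential
          using r a by (intro exI[of _ "\<lambda>n. r n *\<^sub>R a n"]) (auto intro: tendsto_scaleR)
      qed
    qed
  qed
  ultimately show thesis by (rule that)
qed

section \<open>Weak* sequential compactness\<close>

lemma abs_blinfun_le:
  fixes f :: "'p::real_normed_vector \<Rightarrow>\<^sub>L real"
  assumes "norm f \<le> C"
  shows "\<bar>blinfun_apply f x\<bar> \<le> C * norm x"
  using norm_blinfun[of f x] mult_right_mono[OF assms norm_ge_zero[of x]] by simp

lemma blinfun_pointwise_limit:
  fixes f :: "nat \<Rightarrow> 'p::real_normed_vector \<Rightarrow>\<^sub>L real"
  assumes bd: "\<And>n. norm (f n) \<le> C" and conv: "\<And>x. convergent (\<lambda>n. blinfun_apply (f n) x)"
  obtains l :: "'p \<Rightarrow>\<^sub>L real"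
  where "\<And>x. (\<lambda>n. blinfun_apply (f n) x) \<longlonglongrightarrow> blinfun_apply l x"
proof -
  define h where "h x = lim (\<lambda>n. blinfun_apply (f n) x)" for x
  have h: "(\<lambda>n. blinfun_apply (f n) x) \<longlonglongrightarrow> h x" for x
    using conv[of x] by (simp add: h_def convergent_LIMSEQ_iff)
  have "linear h"
  proof (rule linearI)
    show "h (x + y) = h x + h y" for x y
      using LIMSEQ_unique[OF h[of "x + y"]] tendsto_add[OF h[of x] h[of y]]
      by (simp add: blinfun.add_right)
    show "h (c *\<^sub>R x) = c *\<^sub>R h x" for c x
      using LIMSEQ_unique[OF h[of "c *\<^sub>R x"]] tendsto_scaleR[OF tendsto_const h[of x]]
      by (simp add: blinfun.scaleR_right)
  qed
  moreover have "h x \<le> C * norm x" for x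
    using abs_blinfun_le[OF bd, of _ x] by (intro LIMSEQ_le_const2[OF h]) (auto simp: abs_le_iff)
  ultimately have "bounded_linear h" by (rule linear_le_norm_imp_bounded_linear)
  then show thesis using h that[of "Blinfun h"] by (simp add: bounded_linear_Blinfun_apply)
qed

text \<open>The diagonal extraction asks for a bound that does not depend on the vector. Normalizing
  by \<open>sgn\<close> supplies the bound \<open>C\<close>; the factor \<open>norm x\<close> is
  restored afterwards.\<close>

lemma convergent_subseq_on_countable:
  fixes f :: "nat \<Rightarrow> 'p::real_normed_vector \<Rightarrow>\<^sub>L real"
  assumes bd: "\<And>n. norm (f n) \<le> C" and "countable S"
  obtains r :: "nat \<Rightarrow> nat" where "strict_mono r"
    "\<And>x. x \<in> S \<Longrightarrow> convergent (\<lambda>n. blinfun_apply (f (r n)) x)"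
proof -
  have "0 \<le> C" using bd[of 0] norm_ge_zero[of "f 0"] by linarith
  then have "C * norm (sgn x) \<le> C" for x :: 'p by (simp add: norm_sgn)
  then have "norm (blinfun_apply (f n) (sgn x)) \<le> C" for n x
    using abs_blinfun_le[OF bd, of n "sgn x"] by (simp add: order_trans)
  then obtain r where r: "strict_mono (r :: nat \<Rightarrow> nat)"
    "\<And>x. x \<in> S \<Longrightarrow> \<exists>l. (\<lambda>n. blinfun_apply (f (r n)) (sgn x)) \<longlonglongrightarrow> l"
    using function_convergent_subsequence[OF \<open>countable S\<close>,
        of "\<lambda>n x. blinfun_apply (f n) (sgn x)" C] by blast
  have eq: "blinfun_apply \<phi> x = norm x * blinfun_apply \<phi> (sgn x)" for \<phi> :: "'p \<Rightarrow>\<^sub>L real" and x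
    by (cases "x = 0") (simp_all add: sgn_div_norm blinfun.scaleR_right blinfun.zero_right)
  have "convergent (\<lambda>n. blinfun_apply (f (r n)) x)" if "x \<in> S" for x
    unfolding eq[of _ x] using r(2)[OF that] by (intro convergent_mult) (auto simp: convergent_def)
  with r(1) show thesis by (rule that)
qed

lemma convergent_on_dense_imp_convergent:
  fixes f :: "nat \<Rightarrow> 'p::real_normed_vector \<Rightarrow>\<^sub>L real"
  assumes bd: "\<And>n. norm (f n) \<le> C" and "closure S = UNIV"
    and conv: "\<And>x. x \<in> S \<Longrightarrow> convergent (\<lambda>n. blinfun_apply (f n) x)"
  shows "convergent (\<lambda>n. blinfun_apply (f n) x)"
proof -
  have C: "0 \<le> C" using bd[of 0] norm_ge_zero[of "f 0"] by linarith
  have "Cauchy (\<lambda>n. blinfun_apply (f n) x)"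
  proof (rule metric_CauchyI)
    fix e :: real assume "0 < e"
    \<comment> \<open>The summand 1 guards against \<open>C = 0\<close>.\<close>
    then have "0 < e / (3 * (C + 1))" using C by simp
    then obtain y where y: "y \<in> S" "dist y x < e / (3 * (C + 1))"
      using \<open>closure S = UNIV\<close> by (metis UNIV_I closure_approachable)
    have "C * norm (x - y) \<le> (C + 1) * norm (x - y)" by (simp add: mult_right_mono)
    also have "\<dots> < e / 3" using y(2) C by (simp add: dist_norm norm_minus_commute field_simps)
    finally have small: "\<bar>blinfun_apply (f n) x - blinfun_apply (f n) y\<bar> < e / 3" for n
      using abs_blinfun_le[OF bd, of n "x - y"] by (simp add: blinfun.diff_right)
    have "Cauchy (\<lambda>n. blinfun_apply (f n) y)" using conv[OF y(1)] by (rule convergent_Cauchy)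
    then obtain N where
      N: "\<And>m n. m \<ge> N \<Longrightarrow> n \<ge> N \<Longrightarrow> dist (blinfun_apply (f m) y) (blinfun_apply (f n) y) < e / 3"
      using metric_CauchyD[of "\<lambda>n. blinfun_apply (f n) y" "e / 3"] \<open>0 < e\<close> by auto
    have "dist (blinfun_apply (f m) x) (blinfun_apply (f n) x) < e" if "m \<ge> N" "n \<ge> N" for m n
      using N[OF that] small[of m] small[of n] unfolding dist_real_def by linarith
    then show "\<exists>N. \<forall>m\<ge>N. \<forall>n\<ge>N. dist (blinfun_apply (f m) x) (blinfun_apply (f n) x) < e"
      by blast
  qed
  then show ?thesis by (simp add: Cauchy_convergent_iff)
qed

text \<open>The Hahn-Banach theorem is applied to \<open>x \<mapsto> limsup f\<^sub>n(x)\<close>.\<close>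

lemma cluster_functional:
  fixes f :: "nat \<Rightarrow> 'p::real_normed_vector \<Rightarrow>\<^sub>L real" and v :: 'p
  assumes bd: "\<And>n. norm (f n) \<le> C"
  obtains l :: "'p \<Rightarrow>\<^sub>L real"
  where "\<And>x c. \<forall>\<^sub>F n in sequentially. blinfun_apply (f n) x \<le> c \<Longrightarrow> blinfun_apply l x \<le> c"
    and "\<And>c. blinfun_apply l v < c \<Longrightarrow> \<forall>\<^sub>F n in sequentially. blinfun_apply (f n) v \<le> c"
proof -
  \<comment> \<open>The infimum of the eventual upper bounds is a real-valued limit superior; the
    bound \<open>C\<close> keeps \<open>S x\<close> nonempty and bounded below.\<close>
  define S where "S x = {c. \<forall>\<^sub>F n in sequentially. blinfun_apply (f n) x \<le> c}" for x
  define p where "p x = Inf (S x)" for x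
  note bound = abs_blinfun_le[OF bd]
  have mem: "C * norm x \<in> S x" for x
    using bound[of _ x] by (auto simp: S_def abs_le_iff intro!: always_eventually)
  have "- (C * norm x) \<le> c" if c: "c \<in> S x" for x c
  proof -
    obtain n where "blinfun_apply (f n) x \<le> c"
      using c eventually_happens'[OF sequentially_bot] unfolding S_def by blast
    then show ?thesis using bound[of n x] by simp
  qed
  then have bdd: "bdd_below (S x)" for x by (intro bdd_belowI)
  have p_le: "p x \<le> c" if "\<forall>\<^sub>F n in sequentially. blinfun_apply (f n) x \<le> c" for x c
    unfolding p_def by (rule cInf_lower[OF _ bdd]) (use that in \<open>simp add: S_def\<close>)
  have p_less: "\<forall>\<^sub>F n in sequentially. blinfun_apply (f n) x \<le> c" if "p x < c" for x c
  proof -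
    obtain d where "d \<in> S x" "d < c"
      using cInf_lessD[of "S x" c] mem[of x] \<open>p x < c\<close> unfolding p_def by blast
    then show ?thesis unfolding S_def by (auto elim!: eventually_mono)
  qed
  have "sublinear p"
  proof (rule sublinearI)
    fix x y
    show "p (x + y) \<le> p x + p y"
    proof (rule field_le_epsilon)
      fix e :: real assume "0 < e"
      have "\<forall>\<^sub>F n in sequentially. blinfun_apply (f n) x \<le> p x + e / 2"
        "\<forall>\<^sub>F n in sequentially. blinfun_apply (f n) y \<le> p y + e / 2"
        by (rule p_less, use \<open>0 < e\<close> in simp)+
      then have "\<forall>\<^sub>F n in sequentially. blinfun_apply (f n) (x + y) \<le> p x + p y + e"
        by eventually_elim (simp add: blinfun.add_right)
      then show "p (x + y) \<le> p x + p y + e" by (rule p_le)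
    qed
  next
    fix c :: real and x assume c: "0 < c"
    show "p (c *\<^sub>R x) \<le> c * p x"
    proof (rule field_le_epsilon)
      fix e :: real assume "0 < e"
      have "\<forall>\<^sub>F n in sequentially. blinfun_apply (f n) x \<le> p x + e / c"
        by (rule p_less) (use \<open>0 < e\<close> c in simp)
      then have "\<forall>\<^sub>F n in sequentially. blinfun_apply (f n) (c *\<^sub>R x) \<le> c * p x + e"
        by eventually_elim (use c in \<open>simp add: blinfun.scaleR_right field_simps\<close>)
      then show "p (c *\<^sub>R x) \<le> c * p x + e" by (rule p_le)
    qed
  qed
  \<comment> \<open>Equality at \<open>v\<close> makes \<open>h\<close> attain the limit superior
    there, which yields the second claim.\<close>
  then obtain h where h: "linear h" "h \<le> p" "h v = p v" using hahn_banach_sublinear by blast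
  have h_le: "h x \<le> p x" for x using h(2) by (simp add: le_fun_def)
  have "p x \<le> C * norm x" for x
    by (rule p_le) (use mem[of x] in \<open>simp add: S_def\<close>)
  then have "bounded_linear h"
    using h(1) h_le by (intro linear_le_norm_imp_bounded_linear[of h C]) (auto intro: order_trans)
  then have app: "blinfun_apply (Blinfun h) = h" by (rule bounded_linear_Blinfun_apply)
  show thesis
  proof (rule that[of "Blinfun h"])
    show "blinfun_apply (Blinfun h) x \<le> c"
      if "\<forall>\<^sub>F n in sequentially. blinfun_apply (f n) x \<le> c" for x c
      using h_le[of x] p_le[OF that] by (simp add: app)
    show "\<forall>\<^sub>F n in sequentially. blinfun_apply (f n) v \<le> c" if "blinfun_apply (Blinfun h) v < c" for c
      by (rule p_less) (use that h(3) in \<open>simp add: app\<close>)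
  qed
qed

text \<open>Domination by the limit superior at \<open>x\<close> and at \<open>- x\<close> encloses
  the value at \<open>x\<close> between the limits inferior and superior, which coincide
  here.\<close>

lemma cluster_functional_eq_limit:
  fixes f :: "nat \<Rightarrow> 'p::real_normed_vector \<Rightarrow>\<^sub>L real"
  assumes l: "\<And>x c. \<forall>\<^sub>F n in sequentially. blinfun_apply (f n) x \<le> c \<Longrightarrow> blinfun_apply l x \<le> c"
    and lim: "(\<lambda>n. blinfun_apply (f n) x) \<longlonglongrightarrow> a"
  shows "blinfun_apply l x = a"
proof (rule antisym)
  show "blinfun_apply l x \<le> a"
  proof (rule field_le_epsilon)
    fix e :: real assume "0 < e"
    with lim have "\<forall>\<^sub>F n in sequentially. blinfun_apply (f n) x < a + e"
      by (intro order_tendstoD(2)[OF lim]) simp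
    then show "blinfun_apply l x \<le> a + e" by (intro l) (auto elim: eventually_mono)
  qed
  show "a \<le> blinfun_apply l x"
  proof (rule field_le_epsilon)
    fix e :: real assume "0 < e"
    then have "\<forall>\<^sub>F n in sequentially. a - e < blinfun_apply (f n) x"
      by (intro order_tendstoD(1)[OF lim]) simp
    then have "blinfun_apply l (- x) \<le> e - a"
      by (intro l) (auto elim: eventually_mono simp: blinfun.minus_right)
    then show "a \<le> blinfun_apply l x + e" by (simp add: blinfun.minus_right)
  qed
qed

text \<open>The norm need not be attained, hence the factor 2: half of a nonzero norm is no longer a
  bound for \<open>\<psi>\<close>.\<close>

lemma norming_vector:
  fixes \<psi> :: "'p::real_normed_vector \<Rightarrow>\<^sub>L real"
  obtains x where "norm x \<le> 1" "norm \<psi> \<le> 2 * \<bar>blinfun_apply \<psi> x\<bar>"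
proof (cases "\<psi> = 0")
  case True
  then show thesis using that[of 0] by simp
next
  case False
  have "\<not> (\<forall>x. norm (blinfun_apply \<psi> x) \<le> norm \<psi> / 2 * norm x)"
    using norm_blinfun_bound[of "norm \<psi> / 2" \<psi>] False by auto
  then obtain x where x: "norm \<psi> / 2 * norm x < \<bar>blinfun_apply \<psi> x\<bar>"
    by (auto simp: not_le)
  then have "x \<noteq> 0" by auto
  then have "norm \<psi> < 2 * \<bar>blinfun_apply \<psi> (sgn x)\<bar>"
    using x by (simp add: sgn_div_norm blinfun.scaleR_right abs_mult field_simps)
  then show thesis using that[of "sgn x"] by (simp add: norm_sgn)
qed

text \<open>Two cluster functionals of a subsequence agree on the norming vectors of a countable dense
  subset of the span of the \<open>f\<^sub>n\<close>; since by reflexivity their difference lies in the closure of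
  this span, it vanishes.\<close>

lemma reflexive_convergent_subseq:
  fixes f :: "nat \<Rightarrow> 'p::banach \<Rightarrow>\<^sub>L real"
  assumes refl: "reflexive_space TYPE('p)" and bd: "\<And>n. norm (f n) \<le> C"
  obtains r :: "nat \<Rightarrow> nat" where "strict_mono r" "\<And>x. convergent (\<lambda>n. blinfun_apply (f (r n)) x)"
proof -
  obtain Q where Q: "countable Q" "span (range f) \<subseteq> closure Q"
    using countable_dense_in_span[of "range f"] by auto
  define X :: "('p \<Rightarrow>\<^sub>L real) \<Rightarrow> 'p"
    where "X \<psi> = (SOME x. norm x \<le> 1 \<and> norm \<psi> \<le> 2 * \<bar>blinfun_apply \<psi> x\<bar>)" for \<psi>
  have X: "norm (X \<psi>) \<le> 1 \<and> norm \<psi> \<le> 2 * \<bar>blinfun_apply \<psi> (X \<psi>)\<bar>" for \<psi>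
    unfolding X_def by (rule someI_ex) (rule norming_vector[of \<psi>], blast)
  \<comment> \<open>\<open>Q\<close> comes from the full sequence and is fixed before the
    extraction; convergence is arranged only on its countable image under \<open>X\<close>.\<close>
  obtain r :: "nat \<Rightarrow> nat" where r: "strict_mono r"
    "\<And>x. x \<in> X ` Q \<Longrightarrow> convergent (\<lambda>n. blinfun_apply (f (r n)) x)"
    using convergent_subseq_on_countable[of f, OF bd countable_image[OF Q(1), of X]] by blast
  have "convergent (\<lambda>n. blinfun_apply (f (r n)) x)" for x
  proof -
    \<comment> \<open>\<open>l\<close> attains the limit superior at \<open>x\<close>, and
      \<open>m\<close> below the one at \<open>- x\<close>, so its value at \<open>x\<close> is the
      limit inferior. Hence \<open>l = m\<close> will give convergence at \<open>x\<close>.\<close>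
    obtain l :: "'p \<Rightarrow>\<^sub>L real" where
      l: "\<And>y c. \<forall>\<^sub>F n in sequentially. blinfun_apply (f (r n)) y \<le> c \<Longrightarrow> blinfun_apply l y \<le> c"
        "\<And>c. blinfun_apply l x < c \<Longrightarrow> \<forall>\<^sub>F n in sequentially. blinfun_apply (f (r n)) x \<le> c"
      using cluster_functional[of "\<lambda>n. f (r n)" C x, OF bd] by blast
    obtain m :: "'p \<Rightarrow>\<^sub>L real" where
      m: "\<And>y c. \<forall>\<^sub>F n in sequentially. blinfun_apply (f (r n)) y \<le> c \<Longrightarrow> blinfun_apply m y \<le> c"
        "\<And>c. blinfun_apply m (- x) < c \<Longrightarrow>
          \<forall>\<^sub>F n in sequentially. blinfun_apply (f (r n)) (- x) \<le> c"
      using cluster_functional[of "\<lambda>n. f (r n)" C "- x", OF bd] by blast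
    have agree: "blinfun_apply (l - m) y = 0" if conv: "convergent (\<lambda>n. blinfun_apply (f (r n)) y)" for y
    proof -
      obtain a where "(\<lambda>n. blinfun_apply (f (r n)) y) \<longlonglongrightarrow> a"
        using conv by (auto simp: convergent_def)
      then have "blinfun_apply l y = a" "blinfun_apply m y = a"
        using cluster_functional_eq_limit[of "\<lambda>n. f (r n)", OF l(1)]
          cluster_functional_eq_limit[of "\<lambda>n. f (r n)", OF m(1)] by simp_all
      then show ?thesis by (simp add: blinfun.diff_left)
    qed
    \<comment> \<open>Where all \<open>f n\<close> vanish, the sequence trivially converges, so
      \<open>agree\<close> makes \<open>l - m\<close> vanish there too.\<close>
    have "l - m \<in> closure (span (range f))"
    proof (rule reflexive_annihilator[OF refl subspace_span])
      fix y assume "\<And>\<psi>. \<psi> \<in> span (range f) \<Longrightarrow> blinfun_apply \<psi> y = 0"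
      then have "blinfun_apply (f (r n)) y = 0" for n by (simp add: span_base)
      then show "blinfun_apply (l - m) y = 0" by (intro agree) (simp add: convergent_const)
    qed
    then have closure: "l - m \<in> closure Q"
      using closure_minimal[OF Q(2) closed_closure] by blast
    have "norm (l - m) \<le> 0"
    proof (rule field_le_epsilon)
      fix e :: real assume "0 < e"
      \<comment> \<open>The norm of \<open>l - m\<close> will be at most three times its distance to
        \<open>\<psi>\<close>: once by the triangle inequality, twice because \<open>\<psi>\<close>
        is normed up to the factor 2 by a zero of \<open>l - m\<close>.\<close>
      then obtain \<psi> where \<psi>: "\<psi> \<in> Q" "dist \<psi> (l - m) < e / 3"
        using closure by (metis closure_approachable divide_pos_pos zero_less_numeral)
      have "blinfun_apply (l - m) (X \<psi>) = 0" using r(2) \<psi>(1) by (intro agree) blast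
      then have "\<bar>blinfun_apply \<psi> (X \<psi>)\<bar> = \<bar>blinfun_apply (\<psi> - (l - m)) (X \<psi>)\<bar>"
        by (simp add: blinfun.diff_left)
      also have "\<dots> \<le> norm (\<psi> - (l - m)) * norm (X \<psi>)" by (rule abs_blinfun_le) simp
      also have "\<dots> \<le> norm (\<psi> - (l - m))" using X[of \<psi>] by (simp add: mult_left_le)
      finally have "norm \<psi> \<le> 2 * norm (\<psi> - (l - m))" using X[of \<psi>] by linarith
      moreover have "norm (l - m) \<le> norm \<psi> + norm (\<psi> - (l - m))"
        by (metis norm_minus_commute norm_triangle_sub)
      ultimately show "norm (l - m) \<le> 0 + e" using \<psi>(2) by (simp add: dist_norm)
    qed
    then have "l = m" by simp
    have "(\<lambda>n. blinfun_apply (f (r n)) x) \<longlonglongrightarrow> blinfun_apply l x"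
    proof (rule order_tendstoI)
      fix c assume "blinfun_apply l x < c"
      then obtain d where "blinfun_apply l x < d" "d < c" using dense by blast
      from l(2)[OF this(1)] show "\<forall>\<^sub>F n in sequentially. blinfun_apply (f (r n)) x < c"
        by eventually_elim (use \<open>d < c\<close> in simp)
    next
      fix c assume "c < blinfun_apply l x"
      then obtain d where d: "c < d" "d < blinfun_apply l x" using dense by blast
      then have "blinfun_apply m (- x) < - d" using \<open>l = m\<close> by (simp add: blinfun.minus_right)
      from m(2)[OF this] show "\<forall>\<^sub>F n in sequentially. c < blinfun_apply (f (r n)) x"
        by eventually_elim (use \<open>c < d\<close> in \<open>simp add: blinfun.minus_right\<close>)
    qed
    then show ?thesis by (auto simp: convergent_def)
  qed
  with r(1) show thesis by (rule that)
qed

lemma separable_convergent_subseq: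
  fixes f :: "nat \<Rightarrow> 'p::real_normed_vector \<Rightarrow>\<^sub>L real"
  assumes "separable_space (euclidean :: 'p topology)" and bd: "\<And>n. norm (f n) \<le> C"
  obtains r :: "nat \<Rightarrow> nat" where "strict_mono r" "\<And>x. convergent (\<lambda>n. blinfun_apply (f (r n)) x)"
proof -
  obtain S :: "'p set" where S: "countable S" "closure S = UNIV"
    using assms(1) by (auto simp: separable_space_def)
  obtain r :: "nat \<Rightarrow> nat" where r: "strict_mono r"
    "\<And>x. x \<in> S \<Longrightarrow> convergent (\<lambda>n. blinfun_apply (f (r n)) x)"
    using convergent_subseq_on_countable[of f, OF bd S(1)] by blast
  have "convergent (\<lambda>n. blinfun_apply (f (r n)) x)" for x
    by (rule convergent_on_dense_imp_convergent[OF bd S(2) r(2)])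
  with r(1) show thesis by (rule that)
qed

lemma weak_star_seq_compact:
  fixes D :: "'x::banach \<Rightarrow> 'p::banach \<Rightarrow>\<^sub>L real" and x :: "nat \<Rightarrow> 'x"
  assumes D: "is_predual D"
    and "separable_space (euclidean :: 'p topology) \<or> reflexive_space TYPE('p)"
    and bd: "\<And>n. norm (x n) \<le> C"
  obtains r l where "strict_mono r" "limitin (weak_star D) (x \<circ> r) l sequentially"
proof -
  have bd': "norm (D (x n)) \<le> C" for n using D bd by (simp add: is_predual_def)
  obtain r :: "nat \<Rightarrow> nat"
    where r: "strict_mono r" "\<And>\<phi>. convergent (\<lambda>n. blinfun_apply (D (x (r n))) \<phi>)"
    using assms(2) separable_convergent_subseq[of "\<lambda>n. D (x n)" C]
      reflexive_convergent_subseq[of "\<lambda>n. D (x n)" C] bd' by metis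
  obtain l where l: "\<And>\<phi>. (\<lambda>n. blinfun_apply (D (x (r n))) \<phi>) \<longlonglongrightarrow> blinfun_apply l \<phi>"
    using blinfun_pointwise_limit[of "\<lambda>n. D (x (r n))" C] bd' r(2) by blast
  \<comment> \<open>Surjectivity of \<open>D\<close> represents the limit functional by a point of
    the space.\<close>
  obtain u where "D u = l" using D by (metis is_predual_def bij_pointE)
  with l have "limitin (weak_star D) (x \<circ> r) u sequentially" by (simp add: limitin_weak_star_iff)
  with r(1) show thesis by (rule that)
qed

section \<open>Weak* limits, norms and strongly convergent perturbations\<close>

lemma weak_star_norm_lsc:
  assumes D: "is_predual D" and lim: "limitin (weak_star D) x l F" and c: "c < norm l"
  shows "\<forall>\<^sub>F i in F. c < norm (x i)"
proof (cases "c < 0")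
  case True
  then show ?thesis by (intro always_eventually) (auto intro: less_le_trans)
next
  case False
  have norm_D: "norm (D u) = norm u" for u using D by (simp add: is_predual_def)
  \<comment> \<open>The dual norm is a supremum of moduli of evaluations, so a single weak*
    continuous evaluation already witnesses the strict bound.\<close>
  have "\<not> (\<forall>\<phi>. norm (blinfun_apply (D l) \<phi>) \<le> c * norm \<phi>)"
    using norm_blinfun_bound[of c "D l"] False c norm_D[of l] by auto
  then obtain \<phi> where \<phi>: "c * norm \<phi> < \<bar>blinfun_apply (D l) \<phi>\<bar>" by (auto simp: not_le)
  have "((\<lambda>i. \<bar>blinfun_apply (D (x i)) \<phi>\<bar>) \<longlongrightarrow> \<bar>blinfun_apply (D l) \<phi>\<bar>) F"
    using lim by (intro tendsto_rabs) (simp add: limitin_weak_star_iff)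
  from order_tendstoD(1)[OF this \<phi>] show ?thesis
  proof eventually_elim
    case (elim i)
    also have "\<bar>blinfun_apply (D (x i)) \<phi>\<bar> \<le> norm (x i) * norm \<phi>"
      by (rule abs_blinfun_le) (simp add: norm_D)
    finally show ?case by (rule mult_right_less_imp_less) simp
  qed
qed

text \<open>This lets the data vary with the index: residuals inherit weak* convergence from the
  images under \<open>K\<close> and norm convergence from the data.\<close>

lemma weak_star_diff_strong:
  assumes D: "is_predual D" and lim: "limitin (weak_star D) x l F" and g: "(g \<longlongrightarrow> g0) F"
  shows "limitin (weak_star D) (\<lambda>i. x i - g i) (l - g0) F"
  unfolding limitin_weak_star_iff
proof
  fix \<phi>
  have "linear D" and norm_D: "norm (D u) = norm u" for u using D by (auto simp: is_predual_def)
  have "bounded_linear D"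
    using \<open>linear D\<close> by (intro bounded_linear_intro[where K = 1])
      (auto simp: norm_D linear_add linear_scale)
  then have "((\<lambda>i. D (g i)) \<longlongrightarrow> D g0) F" using g by (rule bounded_linear.tendsto)
  then have "((\<lambda>i. blinfun_apply (D (x i)) \<phi> - blinfun_apply (D (g i)) \<phi>)
      \<longlongrightarrow> blinfun_apply (D l) \<phi> - blinfun_apply (D g0) \<phi>) F"
    using lim by (intro tendsto_diff[OF _ blinfun.tendsto] tendsto_const)
      (auto simp: limitin_weak_star_iff)
  then show "((\<lambda>i. blinfun_apply (D (x i - g i)) \<phi>) \<longlongrightarrow> blinfun_apply (D (l - g0)) \<phi>) F"
    using \<open>linear D\<close> by (simp add: linear_diff blinfun.diff_left)
qed

section \<open>Stability of Tikhonov minimizers\<close>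

text \<open>If infinitely many terms miss a ball around \<open>l\<close>, they form a subsequence
  none of whose subsequences can tend to \<open>l\<close>.\<close>

lemma subseq_imp_tendsto:
  fixes f :: "nat \<Rightarrow> 'a::metric_space"
  assumes "\<And>r :: nat \<Rightarrow> nat. strict_mono r \<Longrightarrow>
    \<exists>s :: nat \<Rightarrow> nat. strict_mono s \<and> (\<lambda>n. f (r (s n))) \<longlonglongrightarrow> l"
  shows "f \<longlonglongrightarrow> l"
proof (rule ccontr)
  assume "\<not> f \<longlonglongrightarrow> l"
  then obtain e where e: "0 < e" "\<exists>\<^sub>F n in sequentially. \<not> dist (f n) l < e"
    unfolding tendsto_iff frequently_def by auto
  have "infinite {n. \<not> dist (f n) l < e}"
    using e(2) by (simp add: frequently_cofinite flip: cofinite_eq_sequentially)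
  then obtain r :: "nat \<Rightarrow> nat" where r: "strict_mono r" "\<And>n. \<not> dist (f (r n)) l < e"
    using infinite_enumerate by blast
  obtain s where "(\<lambda>n. f (r (s n))) \<longlonglongrightarrow> l" using assms[OF r(1)] by blast
  then have "\<forall>\<^sub>F n in sequentially. dist (f (r (s n))) l < e"
    using e(1) by (rule tendstoD)
  then show False using r(2) by simp
qed

locale tikhonov =
  fixes DX :: "'x::banach \<Rightarrow> 'xp::banach \<Rightarrow>\<^sub>L real"
    and DY :: "'y::banach \<Rightarrow> 'yp::banach \<Rightarrow>\<^sub>L real"
    and K :: "'x \<Rightarrow> 'y" and R :: "'x \<Rightarrow> ereal" and p \<alpha> :: real and g0 :: 'y
  assumes DX: "is_predual DX" and DY: "is_predual DY"
    and predual: "separable_space (euclidean :: 'xp topology) \<or> reflexive_space TYPE('xp)"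
    and R_nonneg: "0 \<le> R v" and R_proper: "proper R"
    and p: "0 < p" and \<alpha>: "0 < \<alpha>"
    and coercive: "(Tikhonov K R p \<alpha> g0 \<longlongrightarrow> \<infinity>) at_infinity"
    and R_lsc: "seq_lower_semicontinuous (weak_star DX) R"
    and K_cont: "seq_continuous (weak_star DX) (weak_star DY) K"
begin

abbreviation "J \<equiv> Tikhonov K R p \<alpha>"

lemma residual_lsc:
  assumes x: "limitin (weak_star DX) x l sequentially" and g: "g \<longlonglongrightarrow> g0"
    and c: "c < norm (K l - g0) powr p"
  shows "\<forall>\<^sub>F n in sequentially. c < norm (K (x n) - g n) powr p"
proof (cases "c < 0")
  case True
  then show ?thesis by (intro always_eventually) (auto intro: less_le_trans)
next
  case False
  \<comment> \<open>The threshold is moved to its p-th root, where lower semi-continuity of the norm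
    applies, and raised back afterwards; this requires \<open>c\<close> to be nonnegative.\<close>
  have "c powr (1 / p) < (norm (K l - g0) powr p) powr (1 / p)"
    using False c p by (intro powr_less_mono2) auto
  then have "c powr (1 / p) < norm (K l - g0)" using p by (simp add: powr_powr)
  moreover have "limitin (weak_star DY) (\<lambda>n. K (x n) - g n) (K l - g0) sequentially"
    using K_cont x g by (intro weak_star_diff_strong DY) (auto simp: seq_continuous_def)
  ultimately have "\<forall>\<^sub>F n in sequentially. c powr (1 / p) < norm (K (x n) - g n)"
    by (intro weak_star_norm_lsc[OF DY])
  then show ?thesis
  proof eventually_elim
    case (elim n)
    then have "(c powr (1 / p)) powr p < norm (K (x n) - g n) powr p"
      using p by (intro powr_less_mono2) auto
    then show ?case using False p by (simp add: powr_powr)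
  qed
qed

lemma J_lsc:
  assumes x: "limitin (weak_star DX) x l sequentially" and g: "g \<longlonglongrightarrow> g0"
  shows "J g0 l \<le> liminf (\<lambda>n. J (g n) (x n))"
proof -
  have "ereal (norm (K l - g0) powr p) \<le> liminf (\<lambda>n. ereal (norm (K (x n) - g n) powr p))"
    unfolding le_Liminf_iff
  proof (intro allI impI)
    fix y assume y: "y < ereal (norm (K l - g0) powr p)"
    then show "\<forall>\<^sub>F n in sequentially. y < ereal (norm (K (x n) - g n) powr p)"
      using residual_lsc[OF x g] by (cases y) auto
  qed
  moreover have "ereal \<alpha> * R l \<le> liminf (\<lambda>n. ereal \<alpha> * R (x n))"
    using R_lsc x \<alpha>
    by (subst Liminf_ereal_mult_left) (auto simp: seq_lower_semicontinuous_def intro!: ereal_mult_left_mono)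
  ultimately have "J g0 l \<le> liminf (\<lambda>n. ereal (norm (K (x n) - g n) powr p)) +
      liminf (\<lambda>n. ereal \<alpha> * R (x n))"
    unfolding Tikhonov_def by (rule add_mono)
  also have "\<dots> \<le> liminf (\<lambda>n. J (g n) (x n))"
  proof -
    \<comment> \<open>Superadditivity of the limit inferior in \<open>ereal\<close> must exclude
      opposite infinities; nonnegativity of both summands does so.\<close>
    have nonneg: "0 \<le> liminf (\<lambda>n. ereal (norm (K (x n) - g n) powr p))"
      "0 \<le> liminf (\<lambda>n. ereal \<alpha> * R (x n))"
      using \<alpha> R_nonneg by (intro Liminf_bounded always_eventually allI; simp)+
    show ?thesis
      unfolding Tikhonov_def by (rule ereal_liminf_add_mono) (use nonneg in auto)
  qed
  finally show ?thesis .
qed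

lemma J_tendsto:
  assumes "g \<longlonglongrightarrow> g0"
  shows "(\<lambda>n. J (g n) v) \<longlonglongrightarrow> J g0 v"
proof -
  have "(\<lambda>n. ereal (norm (K v - g n) powr p)) \<longlonglongrightarrow> ereal (norm (K v - g0) powr p)"
    using p by (intro tendsto_intros assms tendsto_powr') auto
  moreover have "0 \<le> ereal \<alpha> * R v" using \<alpha> R_nonneg by simp
  ultimately show ?thesis
    unfolding Tikhonov_def by (intro tendsto_add_ereal_general tendsto_const) auto
qed

section \<open>Boundedness and limits of the minimizers\<close>

lemma R_finite_point:
  obtains v where "\<bar>R v\<bar> \<noteq> \<infinity>"
  using R_proper by (auto simp: proper_def)

text \<open>Comparison with a point of finite penalty makes the minimal value finite, and positivity
  of \<open>\<alpha>\<close> passes this on to \<open>R u\<close>. Later estimates can then be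
  carried out in the reals.\<close>

lemma minimizer_R_finite:
  assumes "minimizer (J g) u"
  shows "\<bar>R u\<bar> \<noteq> \<infinity>"
proof -
  obtain v where v: "\<bar>R v\<bar> \<noteq> \<infinity>" using R_finite_point .
  have "J g u \<le> J g v" using assms by (simp add: minimizer_def)
  moreover have "J g v < \<infinity>" using v by (cases "R v") (auto simp: Tikhonov_def)
  ultimately show ?thesis using \<alpha> R_nonneg[of u] by (cases "R u") (auto simp: Tikhonov_def)
qed

text \<open>A competitor \<open>v\<close> stays fixed, so its values converge with the data; only
  the minimizers call for lower semi-continuity.\<close>

lemma limit_is_minimizer:
  assumes g: "g \<longlonglongrightarrow> g0" and u: "\<And>n. minimizer (J (g n)) (u n)"
    and l: "limitin (weak_star DX) u l sequentially"
  shows "minimizer (J g0) l"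
  unfolding minimizer_def
proof
  fix v
  have "J g0 l \<le> liminf (\<lambda>n. J (g n) (u n))" by (rule J_lsc[OF l g])
  also have "\<dots> \<le> liminf (\<lambda>n. J (g n) v)"
    using u by (intro Liminf_mono always_eventually) (simp add: minimizer_def)
  also have "\<dots> = J g0 v"
    by (rule lim_imp_Liminf[OF sequentially_bot J_tendsto[OF g]])
  finally show "J g0 l \<le> J g0 v" .
qed

lemma minimizers_bounded:
  assumes g: "g \<longlonglongrightarrow> g0" and u: "\<And>n. minimizer (J (g n)) (u n)"
  obtains C where "\<And>n. norm (u n) \<le> C"
proof -
  obtain v where v: "\<bar>R v\<bar> \<noteq> \<infinity>" using R_finite_point .
  then obtain \<rho> where \<rho>: "R v = ereal \<rho>" by (cases "R v") auto
  have "(\<lambda>n. norm (K v - g n) powr p + \<alpha> * \<rho>) \<longlonglongrightarrow> norm (K v - g0) powr p + \<alpha> * \<rho>"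
    using p by (intro tendsto_intros g tendsto_powr') auto
  then obtain B where B: "\<And>n. \<bar>norm (K v - g n) powr p + \<alpha> * \<rho>\<bar> \<le> B"
    by (elim BseqE[OF convergent_imp_Bseq[OF convergentI]]) auto
  have "Bseq (\<lambda>n. g n - g0)"
    by (rule convergent_imp_Bseq[OF convergentI[OF LIM_zero[OF g]]])
  then obtain M where M: "\<And>n. norm (g n - g0) \<le> M" unfolding Bseq_def by blast
  have "0 \<le> B" using B[of 0] by linarith
  \<comment> \<open>\<open>B\<close> bounds the minimal values through the fixed competitor
    \<open>v\<close>, and \<open>M\<close> bounds the data error. The residual is at most
    \<open>B powr (1 / p)\<close> for \<open>g n\<close>, hence at most \<open>M\<close> more for
    \<open>g0\<close>; the last \<open>B\<close> covers the penalty.\<close>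
  have J_le: "J g0 (u n) \<le> ereal ((B powr (1 / p) + M) powr p + B)" for n
  proof -
    obtain \<sigma> where \<sigma>: "R (u n) = ereal \<sigma>" "0 \<le> \<sigma>"
      using minimizer_R_finite[OF u[of n]] R_nonneg[of "u n"] by (cases "R (u n)") auto
    have "J (g n) (u n) \<le> J (g n) v" using u by (simp add: minimizer_def)
    then have le: "norm (K (u n) - g n) powr p + \<alpha> * \<sigma> \<le> B"
      using B[of n] by (simp add: Tikhonov_def \<sigma>(1) \<rho>)
    have "0 \<le> \<alpha> * \<sigma>" using \<alpha> \<sigma>(2) by simp
    then have "norm (K (u n) - g n) powr p \<le> B" using le by linarith
    then have "(norm (K (u n) - g n) powr p) powr (1 / p) \<le> B powr (1 / p)"
      using p by (intro powr_mono2) auto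
    then have "norm (K (u n) - g n) \<le> B powr (1 / p)" using p by (simp add: powr_powr)
    then have "norm (K (u n) - g0) \<le> B powr (1 / p) + M"
      using norm_triangle_ineq[of "K (u n) - g n" "g n - g0"] M[of n] by simp
    then have "norm (K (u n) - g0) powr p \<le> (B powr (1 / p) + M) powr p"
      using p by (intro powr_mono2) auto
    moreover have "\<alpha> * \<sigma> \<le> B" using le powr_ge_zero[of "norm (K (u n) - g n)" p] by linarith
    ultimately show ?thesis by (simp add: Tikhonov_def \<sigma>(1))
  qed
  have "\<forall>\<^sub>F x in at_infinity. ereal ((B powr (1 / p) + M) powr p + B) < J g0 x"
    by (rule order_tendstoD(1)[OF coercive]) simp
  then obtain C where C: "\<And>x. C \<le> norm x \<Longrightarrow> ereal ((B powr (1 / p) + M) powr p + B) < J g0 x"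
    unfolding eventually_at_infinity by blast
  have "norm (u n) \<le> C" for n
    using C[of "u n"] J_le[of n] by (meson linear not_le)
  then show thesis by (rule that)
qed

lemma minimizers_subseq:
  assumes g: "g \<longlonglongrightarrow> g0" and u: "\<And>n. minimizer (J (g n)) (u n)"
  obtains r l where "strict_mono r" "minimizer (J g0) l"
    "limitin (weak_star DX) (u \<circ> r) l sequentially"
proof -
  obtain C where "\<And>n. norm (u n) \<le> C" using minimizers_bounded[OF g u] by blast
  then obtain r l where r: "strict_mono r" "limitin (weak_star DX) (u \<circ> r) l sequentially"
    using weak_star_seq_compact[OF DX predual] by blast
  have "(g \<circ> r) \<longlonglongrightarrow> g0" using g r(1) by (rule LIMSEQ_subseq_LIMSEQ)
  then have "minimizer (J g0) l"
    by (rule limit_is_minimizer[OF _ _ r(2)]) (simp add: u)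
  with r show thesis by (intro that)
qed

text \<open>Every subsequence has a further one with limit \<open>l\<close>. The subsequence
  principle is applied to the scalar values at each \<open>\<phi>\<close>, which avoids any
  metrizability of the weak* topology.\<close>

lemma unique_minimizer_limit:
  assumes g: "g \<longlonglongrightarrow> g0" and u: "\<And>n. minimizer (J (g n)) (u n)"
    and unique: "\<And>v. minimizer (J g0) v \<Longrightarrow> v = l"
  shows "limitin (weak_star DX) u l sequentially"
  unfolding limitin_weak_star_iff
proof (intro allI subseq_imp_tendsto)
  fix \<phi> and r :: "nat \<Rightarrow> nat" assume r: "strict_mono r"
  have "(g \<circ> r) \<longlonglongrightarrow> g0" using g r by (rule LIMSEQ_subseq_LIMSEQ)
  then obtain s m where s: "strict_mono s" "minimizer (J g0) m"
    "limitin (weak_star DX) ((u \<circ> r) \<circ> s) m sequentially"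
    by (rule minimizers_subseq[where u = "u \<circ> r"]) (simp_all add: u)
  then have "m = l" by (intro unique)
  with s show "\<exists>s. strict_mono s \<and>
      (\<lambda>n. blinfun_apply (DX (u (r (s n)))) \<phi>) \<longlonglongrightarrow> blinfun_apply (DX l) \<phi>"
    by (auto simp: limitin_weak_star_iff)
qed

text \<open>The values \<open>J (g n) (u n)\<close> converge to \<open>J g0 l\<close>; as both summands are lower semi-continuous,
  each of them converges.\<close>

lemma minimizers_R_tendsto:
  assumes g: "g \<longlonglongrightarrow> g0" and u: "\<And>n. minimizer (J (g n)) (u n)"
    and l: "limitin (weak_star DX) u l sequentially"
  shows "(\<lambda>n. R (u n)) \<longlonglongrightarrow> R l"
proof (rule order_tendstoI)
  fix y assume "y < R l"
  moreover have "R l \<le> liminf (\<lambda>n. R (u n))"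
    using R_lsc l by (simp add: seq_lower_semicontinuous_def)
  ultimately show "\<forall>\<^sub>F n in sequentially. y < R (u n)" by (simp add: le_Liminf_iff)
next
  fix y assume y: "R l < y"
  obtain \<rho> where \<rho>: "R l = ereal \<rho>"
    using minimizer_R_finite[OF limit_is_minimizer[OF g u l]] by (cases "R l") auto
  obtain c where c: "\<rho> < c" "ereal c < y" using ereal_dense2[OF y] \<rho> by auto
  define a where "a = norm (K l - g0) powr p"
  \<comment> \<open>The gap \<open>\<alpha> * (c - \<rho>)\<close> is split evenly: one half for the
    change of data at \<open>l\<close>, one for the possible drop of the residual.\<close>
  define e where "e = \<alpha> * (c - \<rho>) / 2"
  have e: "0 < e" using \<alpha> c(1) by (simp add: e_def)
  have J_l: "J g0 l = ereal (a + \<alpha> * \<rho>)" by (simp add: Tikhonov_def a_def \<rho>)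
  have "\<forall>\<^sub>F n in sequentially. J (g n) l < ereal (a + \<alpha> * \<rho> + e)"
    by (rule order_tendstoD(2)[OF J_tendsto[OF g]]) (use e in \<open>simp add: J_l\<close>)
  moreover have "\<forall>\<^sub>F n in sequentially. a - e < norm (K (u n) - g n) powr p"
    by (rule residual_lsc[OF l g]) (use e in \<open>simp add: a_def\<close>)
  ultimately show "\<forall>\<^sub>F n in sequentially. R (u n) < y"
  proof eventually_elim
    case (elim n)
    obtain \<sigma> where \<sigma>: "R (u n) = ereal \<sigma>"
      using minimizer_R_finite[OF u[of n]] by (cases "R (u n)") auto
    \<comment> \<open>The limit itself serves as the competitor.\<close>
    have "J (g n) (u n) \<le> J (g n) l" using u by (simp add: minimizer_def)
    then have "J (g n) (u n) < ereal (a + \<alpha> * \<rho> + e)" using elim(1) by simp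
    then have "norm (K (u n) - g n) powr p + \<alpha> * \<sigma> < a + \<alpha> * \<rho> + e"
      by (simp add: Tikhonov_def \<sigma>)
    then have "\<alpha> * \<sigma> < \<alpha> * \<rho> + 2 * e" using elim(2) by linarith
    also have "\<dots> = \<alpha> * c" by (simp add: e_def field_simps)
    finally have "\<sigma> < c" using \<alpha> by simp
    then show ?case using c(2) \<sigma> by (simp add: less_trans[of _ "ereal c"])
  qed
qed

lemma minimizers_tendsto:
  assumes "g \<longlonglongrightarrow> g0" "\<And>n. minimizer (J (g n)) (u n)"
    "limitin (weak_star DX) u l sequentially" "H_property DX R"
  shows "u \<longlonglongrightarrow> l"
  using assms(3,4) minimizers_R_tendsto[OF assms(1-3)] by (simp add: H_property_def)

end

text \<open>With constant data and two minimizers, the sequence may alternate between them, so the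
  whole sequence need not converge. The norm convergence in the last part therefore concerns the
  subsequences of the first part and, under uniqueness, the full sequence.\<close>

theorem theorem4p12:
  fixes DX :: "'x::banach \<Rightarrow> 'xp::banach \<Rightarrow>\<^sub>L real"
    and DY :: "'y::banach \<Rightarrow> 'yp::banach \<Rightarrow>\<^sub>L real"
    and K :: "'x \<Rightarrow> 'y"
    and R :: "'x \<Rightarrow> ereal"
    and g\<delta> :: 'y
    and p \<alpha> :: real
    and g :: "nat \<Rightarrow> 'y"
    and u :: "nat \<Rightarrow> 'x"
  assumes "is_predual DX" and "is_predual DY"
    and "separable_space (euclidean :: 'xp topology) \<or> reflexive_space TYPE('xp)"
    and "bounded_dilinear K"
    and "\<forall>v. 0 \<le> R v" and "proper R" and "diconvex R"
    and "p \<ge> 1" and "\<alpha> > 0"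
    and "(Tikhonov K R p \<alpha> g\<delta> \<longlongrightarrow> \<infinity>) at_infinity"
    and "seq_lower_semicontinuous (weak_star DX) R"
    and "seq_continuous (weak_star DX) (weak_star DY) K"
    and "g \<longlonglongrightarrow> g\<delta>"
    and "\<forall>n. minimizer (Tikhonov K R p \<alpha> (g n)) (u n)"
  shows
    "(\<exists>r u\<alpha>. strict_mono r \<and> minimizer (Tikhonov K R p \<alpha> g\<delta>) u\<alpha> \<and>
        limitin (weak_star DX) (u \<circ> r) u\<alpha> sequentially) \<and>
     (\<forall>u\<alpha>. minimizer (Tikhonov K R p \<alpha> g\<delta>) u\<alpha> \<and>
        (\<forall>v. minimizer (Tikhonov K R p \<alpha> g\<delta>) v \<longrightarrow> v = u\<alpha>) \<longrightarrow>
        limitin (weak_star DX) u u\<alpha> sequentially) \<and>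
     (H_property DX R \<longrightarrow>
        (\<forall>r u\<alpha>. strict_mono r \<and> minimizer (Tikhonov K R p \<alpha> g\<delta>) u\<alpha> \<and>
          limitin (weak_star DX) (u \<circ> r) u\<alpha> sequentially \<longrightarrow> (u \<circ> r) \<longlonglongrightarrow> u\<alpha>) \<and>
        (\<forall>u\<alpha>. minimizer (Tikhonov K R p \<alpha> g\<delta>) u\<alpha> \<and>
          (\<forall>v. minimizer (Tikhonov K R p \<alpha> g\<delta>) v \<longrightarrow> v = u\<alpha>) \<longrightarrow> u \<longlonglongrightarrow> u\<alpha>))"
proof -
  interpret tikhonov DX DY K R p \<alpha> g\<delta>
    using assms by unfold_locales auto
  have u: "minimizer (J (g n)) (u n)" for n using assms by simp
  have ur: "minimizer (J ((g \<circ> r) n)) ((u \<circ> r) n)" for r :: "nat \<Rightarrow> nat" and n using u by simp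
  have gr: "(g \<circ> r) \<longlonglongrightarrow> g\<delta>" if "strict_mono r" for r
    using \<open>g \<longlonglongrightarrow> g\<delta>\<close> that by (rule LIMSEQ_subseq_LIMSEQ)
  note unique = unique_minimizer_limit[OF \<open>g \<longlonglongrightarrow> g\<delta>\<close> u]
  show ?thesis
  proof (intro conjI allI impI; (elim conjE)?)
    show "\<exists>r u\<alpha>. strict_mono r \<and> minimizer (J g\<delta>) u\<alpha> \<and>
        limitin (weak_star DX) (u \<circ> r) u\<alpha> sequentially"
      using minimizers_subseq[OF \<open>g \<longlonglongrightarrow> g\<delta>\<close> u] by metis
    show "limitin (weak_star DX) u u\<alpha> sequentially"
      if "\<forall>v. minimizer (J g\<delta>) v \<longrightarrow> v = u\<alpha>" for u\<alpha>
      using that by (intro unique) blast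
    show "(u \<circ> r) \<longlonglongrightarrow> u\<alpha>" if "H_property DX R" "strict_mono r"
      "limitin (weak_star DX) (u \<circ> r) u\<alpha> sequentially" for r u\<alpha>
      using minimizers_tendsto[OF gr ur] that by blast
    show "u \<longlonglongrightarrow> u\<alpha>" if "H_property DX R" "\<forall>v. minimizer (J g\<delta>) v \<longrightarrow> v = u\<alpha>" for u\<alpha>
      using minimizers_tendsto[OF \<open>g \<longlonglongrightarrow> g\<delta>\<close> u unique] that by blast
  qed
qed

end
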